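(* Let $\mathfrak g$ be a complex simple Lie algebra of rank $l$, $q\in\mathbb C$ with $0<|q|<1$, and $\pi\in S_l$. Let $F_q^\pi$ be the associative $\mathbb C$-algebra generated by $e_1,\ldots,e_l$ subject to the relations $$\sum_{r=0}^{1-a_{ij}}(-1)^rq^{rc^\pi_{ij}}\left[{1-a_{ij}\atop r}\right]_{q_i}(e_i)^{1-a_{ij}-r}e_j(e_i)^r=0,\qquad i\neq j .$$ Then the map $\chi_q^\pi:F_q^\pi\to\mathbb C$ defined on generators by $\chi_q^\pi(e_i)=1$, $i=1,\ldots,l$, is a character (unital algebra homomorphism to $\mathbb C$) of $F_q^\pi$.
   Context: Let $(a_{ij})_{i,j=1}^l$ be the Cartan matrix of $\mathfrak g$, $d_1,\ldots,d_l$ coprime positive integers such that $b_{ij}=d_ia_{ij}$ is symmetric, $\alpha_1,\ldots,\alpha_l$ the simple roots (a basis of an $l$-dimensional complex vector space $\mathfrak h^*$), and $(\cdot,\cdot)$ the bilinear form on $\mathfrak h^*$ with $(\alpha_i,\alpha_j)=b_{ij}$, which is invariant under the Weyl group. Let $s_i$ be the reflection in $\alpha_i$, and for $\pi\in S_l$ let $s_\pi=s_{\pi(1)}\cdots s_{\pi(l)}$ be the associated Coxeter element ($1-s_\pi$ is invertible). Put $c^\pi_{ij}=\left(\frac{1+s_\pi}{1-s_\pi}\alpha_i,\alpha_j\right)$. Put $q_i=q^{d_i}$, $[n]_t=\frac{t^n-t^{-n}}{t-t^{-1}}$, $[n]_t!=[n]_t\cdots[1]_t$, $\left[{m\atop n}\right]_t=\frac{[m]_t!}{[n]_t!\,[m-n]_t!}$.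 *)

theory Defs
  imports
    "HOL-Algebra.QuotRing"
    "HOL-Algebra.Module"
    "HOL-Library.Poly_Mapping"
    "HOL-Library.Function_Algebras"
    "HOL-Analysis.Complex_Transcendental"
    "HOL-Combinatorics.Permutations"
begin

section \<open>Complex Lie algebras and their Cartan matrices\<close>

definition fun_scale :: "complex \<Rightarrow> ('g \<Rightarrow> complex) \<Rightarrow> 'g \<Rightarrow> complex"
  where "fun_scale c f = (\<lambda>x. c * f x)"

interpretation functional: vector_space "fun_scale :: complex \<Rightarrow> ('g \<Rightarrow> complex) \<Rightarrow> 'g \<Rightarrow> complex"
  by unfold_locales (auto simp: fun_scale_def plus_fun_def algebra_simps)

locale complex_lie_algebra = vector_space sc
  for sc :: "complex \<Rightarrow> 'g::ab_group_add \<Rightarrow> 'g" +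
  fixes br :: "'g \<Rightarrow> 'g \<Rightarrow> 'g"
  assumes br_linear_right: "Vector_Spaces.linear sc sc (\<lambda>y. br x y)"
    and br_linear_left: "Vector_Spaces.linear sc sc (\<lambda>x. br x y)"
    and br_self: "br x x = 0"
    and jacobi: "br x (br y z) + br y (br z x) + br z (br x y) = 0"
begin

definition lie_ideal :: "'g set \<Rightarrow> bool"
  where "lie_ideal I \<longleftrightarrow> subspace I \<and> (\<forall>x. \<forall>y\<in>I. br x y \<in> I)"

definition ad_diagonalizable :: "'g \<Rightarrow> bool"
  where "ad_diagonalizable x \<longleftrightarrow>
    (\<exists>B. independent B \<and> span B = UNIV \<and> (\<forall>b\<in>B. \<exists>c. br x b = sc c b))"

text \<open>The usual definition for semisimple Lie algebras: a maximal abelian subalgebra all of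
  whose elements are ad-diagonalizable.\<close>
definition cartan_subalgebra :: "'g set \<Rightarrow> bool"
  where "cartan_subalgebra h \<longleftrightarrow>
    subspace h \<and>
    (\<forall>x\<in>h. \<forall>y\<in>h. br x y = 0) \<and>
    (\<forall>x. (\<forall>y\<in>h. br y x = 0) \<longrightarrow> x \<in> h) \<and>
    (\<forall>x\<in>h. ad_diagonalizable x)"

text \<open>A linear functional on \<open>h\<close> is represented by its extension by zero to the whole type, so
  that equality of functionals on \<open>h\<close> is equality of functions.\<close>
definition dual_space :: "'g set \<Rightarrow> ('g \<Rightarrow> complex) set"
  where "dual_space h = {f.
    (\<forall>x\<in>h. \<forall>y\<in>h. f (x + y) = f x + f y) \<and>
    (\<forall>c. \<forall>x\<in>h. f (sc c x) = c * f x) \<and>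
    (\<forall>x. x \<notin> h \<longrightarrow> f x = 0)}"

definition root_space :: "'g set \<Rightarrow> ('g \<Rightarrow> complex) \<Rightarrow> 'g set"
  where "root_space h f = {x. \<forall>y\<in>h. br y x = sc (f y) x}"

definition roots :: "'g set \<Rightarrow> ('g \<Rightarrow> complex) set"
  where "roots h = {f \<in> dual_space h. f \<noteq> 0 \<and> root_space h f \<noteq> {0}}"

definition simple_roots :: "'g set \<Rightarrow> nat \<Rightarrow> (nat \<Rightarrow> 'g \<Rightarrow> complex) \<Rightarrow> bool"
  where "simple_roots h l \<alpha> \<longleftrightarrow>
    \<alpha> ` {1..l} \<subseteq> roots h \<and>
    inj_on \<alpha> {1..l} \<and> functional.independent (\<alpha> ` {1..l}) \<and>
    functional.span (\<alpha> ` {1..l}) = dual_space h \<and>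
    (\<forall>\<beta>\<in>roots h. \<exists>n :: nat \<Rightarrow> nat.
      \<beta> = (\<Sum>i=1..l. fun_scale (of_nat (n i)) (\<alpha> i)) \<or>
      \<beta> = - (\<Sum>i=1..l. fun_scale (of_nat (n i)) (\<alpha> i)))"

definition is_coroot :: "'g set \<Rightarrow> ('g \<Rightarrow> complex) \<Rightarrow> 'g \<Rightarrow> bool"
  where "is_coroot h \<beta> t \<longleftrightarrow>
    t \<in> h \<and> \<beta> t = 2 \<and> (\<exists>x\<in>root_space h \<beta>. \<exists>y\<in>root_space h (- \<beta>). t = br x y)"

text \<open>The convention is \<open>a i j = \<alpha> j (coroot of \<alpha> i)\<close>, that is
  \<open>2 (\<alpha> i, \<alpha> j) / (\<alpha> i, \<alpha> i)\<close>; it is the row scaling \<open>d i * a i j\<close> that is symmetric.\<close>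
definition cartan_matrix ::
    "'g set \<Rightarrow> nat \<Rightarrow> (nat \<Rightarrow> 'g \<Rightarrow> complex) \<Rightarrow> (nat \<Rightarrow> nat \<Rightarrow> int) \<Rightarrow> bool"
  where "cartan_matrix h l \<alpha> a \<longleftrightarrow>
    (\<forall>i\<in>{1..l}. \<exists>t. is_coroot h (\<alpha> i) t \<and> (\<forall>j\<in>{1..l}. of_int (a i j) = \<alpha> j t))"

end

locale simple_lie_algebra = complex_lie_algebra +
  assumes finite_dimensional: "\<exists>B. finite B \<and> span B = UNIV"
    and not_abelian: "\<exists>x y. br x y \<noteq> 0"
    and ideal_trivial: "lie_ideal I \<Longrightarrow> I = {0} \<or> I = UNIV"


section \<open>Coxeter elements\<close>

definition bilinear_form_on ::
    "('g \<Rightarrow> complex) set \<Rightarrow> (('g \<Rightarrow> complex) \<Rightarrow> ('g \<Rightarrow> complex) \<Rightarrow> complex) \<Rightarrow> bool"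
  where "bilinear_form_on V B \<longleftrightarrow>
    (\<forall>x\<in>V. \<forall>y\<in>V. \<forall>z\<in>V. B (x + y) z = B x z + B y z \<and> B z (x + y) = B z x + B z y) \<and>
    (\<forall>c. \<forall>x\<in>V. \<forall>y\<in>V. B (fun_scale c x) y = c * B x y \<and> B x (fun_scale c y) = c * B x y)"

definition reflection ::
    "(('g \<Rightarrow> complex) \<Rightarrow> ('g \<Rightarrow> complex) \<Rightarrow> complex) \<Rightarrow> ('g \<Rightarrow> complex) \<Rightarrow>
      ('g \<Rightarrow> complex) \<Rightarrow> ('g \<Rightarrow> complex)"
  where "reflection B \<beta> x = x - fun_scale (2 * B x \<beta> / B \<beta> \<beta>) \<beta>"

text \<open>The composition \<open>s (\<pi> 1) \<circ> \<dots> \<circ> s (\<pi> l)\<close>; the factor \<open>s (\<pi> l)\<close> acts first.\<close>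
definition coxeter_element ::
    "(('g \<Rightarrow> complex) \<Rightarrow> ('g \<Rightarrow> complex) \<Rightarrow> complex) \<Rightarrow> (nat \<Rightarrow> 'g \<Rightarrow> complex) \<Rightarrow>
      nat \<Rightarrow> (nat \<Rightarrow> nat) \<Rightarrow> ('g \<Rightarrow> complex) \<Rightarrow> ('g \<Rightarrow> complex)"
  where "coxeter_element B \<alpha> l \<pi> = foldr (\<lambda>k f. reflection B (\<alpha> (\<pi> k)) \<circ> f) [1..<Suc l] id"

definition cayley_transform ::
    "('g \<Rightarrow> complex) set \<Rightarrow> (('g \<Rightarrow> complex) \<Rightarrow> ('g \<Rightarrow> complex)) \<Rightarrow> ('g \<Rightarrow> complex) \<Rightarrow> ('g \<Rightarrow> complex)"
  where "cayley_transform V s x = (let y = inv_into V (\<lambda>v. v - s v) x in y + s y)"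

definition coxeter_coeff ::
    "('g \<Rightarrow> complex) set \<Rightarrow> (('g \<Rightarrow> complex) \<Rightarrow> ('g \<Rightarrow> complex) \<Rightarrow> complex) \<Rightarrow>
      (nat \<Rightarrow> 'g \<Rightarrow> complex) \<Rightarrow> nat \<Rightarrow> (nat \<Rightarrow> nat) \<Rightarrow> nat \<Rightarrow> nat \<Rightarrow> complex"
  where "coxeter_coeff V B \<alpha> l \<pi> i j =
    B (cayley_transform V (coxeter_element B \<alpha> l \<pi>) (\<alpha> i)) (\<alpha> j)"


section \<open>Quantum binomial coefficients\<close>

definition q_int :: "complex \<Rightarrow> nat \<Rightarrow> complex"
  where "q_int t n = (t ^ n - inverse t ^ n) / (t - inverse t)"

definition q_fact :: "complex \<Rightarrow> nat \<Rightarrow> complex"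
  where "q_fact t n = (\<Prod>k=1..n. q_int t k)"

definition q_binomial :: "complex \<Rightarrow> nat \<Rightarrow> nat \<Rightarrow> complex"
  where "q_binomial t m n = q_fact t m / (q_fact t n * q_fact t (m - n))"


section \<open>Associative algebras given by generators and relations\<close>

text \<open>With lists as the free monoid, \<open>nat list \<Rightarrow>\<^sub>0 complex\<close> carries the (convolution) ring
  structure of the monoid algebra, which is the free associative algebra.\<close>
instantiation list :: (type) monoid_add
begin

definition zero_list :: "'a list" where "zero_list = []"

definition plus_list :: "'a list \<Rightarrow> 'a list \<Rightarrow> 'a list" where "plus_list = append"

instance by standard (auto simp: zero_list_def plus_list_def)

end

type_synonym free_alg = "nat list \<Rightarrow>\<^sub>0 complex"

definition generator :: "nat \<Rightarrow> free_alg"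
  where "generator i = Poly_Mapping.single [i] 1"

definition scalar :: "complex \<Rightarrow> free_alg"
  where "scalar c = Poly_Mapping.single [] c"

definition free_algebra :: "nat \<Rightarrow> free_alg ring"
  where "free_algebra l =
    \<lparr>carrier = {p. Poly_Mapping.keys p \<subseteq> lists {1..l}},
     monoid.mult = (*), one = 1, zero = 0, add = (+)\<rparr>"

definition complex_field :: "complex ring"
  where "complex_field = \<lparr>carrier = UNIV, monoid.mult = (*), one = 1, zero = 0, add = (+)\<rparr>"

definition relation_ideal :: "nat \<Rightarrow> free_alg set \<Rightarrow> free_alg set"
  where "relation_ideal l S = Idl\<^bsub>free_algebra l\<^esub> S"

definition quotient_class :: "nat \<Rightarrow> free_alg set \<Rightarrow> free_alg \<Rightarrow> free_alg set"
  where "quotient_class l S p = relation_ideal l S +>\<^bsub>free_algebra l\<^esub> p"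

text \<open>Scalars act through the central structure map \<open>c \<mapsto> [c]\<close>; \<open>smult c X\<close> is
  the class of \<open>c p\<close> if \<open>X\<close> is the class of \<open>p\<close>.\<close>
definition presented_algebra :: "nat \<Rightarrow> free_alg set \<Rightarrow> (complex, free_alg set) module"
  where "presented_algebra l S =
    (let Q = free_algebra l Quot relation_ideal l S in
      \<lparr>carrier = carrier Q, monoid.mult = monoid.mult Q, one = one Q, zero = zero Q, add = add Q,
       smult = (\<lambda>c X. quotient_class l S (scalar c) \<otimes>\<^bsub>Q\<^esub> X)\<rparr>)"

definition is_character :: "(complex, 'x) module \<Rightarrow> ('x \<Rightarrow> complex) \<Rightarrow> bool"
  where "is_character A chi \<longleftrightarrow>
    chi \<in> ring_hom A complex_field \<and>
    (\<forall>c. \<forall>x\<in>carrier A. chi (c \<odot>\<^bsub>A\<^esub> x) = c * chi x)"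


section \<open>The algebras defined by the twisted quantum Serre relations\<close>

text \<open>The power \<open>q powr z\<close> uses the principal branch; no choice is involved when \<open>z\<close> is an
  integer.\<close>
definition serre_element ::
    "complex \<Rightarrow> (nat \<Rightarrow> nat \<Rightarrow> int) \<Rightarrow> (nat \<Rightarrow> nat) \<Rightarrow> (nat \<Rightarrow> nat \<Rightarrow> complex) \<Rightarrow> nat \<Rightarrow> nat \<Rightarrow> free_alg"
  where "serre_element q a d c i j =
    (\<Sum>r = 0..nat (1 - a i j).
      scalar ((- 1) ^ r * q powr (of_nat r * c i j) * q_binomial (q ^ d i) (nat (1 - a i j)) r) *
      generator i ^ (nat (1 - a i j) - r) * generator j * generator i ^ r)"

definition serre_relations ::
    "nat \<Rightarrow> complex \<Rightarrow> (nat \<Rightarrow> nat \<Rightarrow> int) \<Rightarrow> (nat \<Rightarrow> nat) \<Rightarrow> (nat \<Rightarrow> nat \<Rightarrow> complex) \<Rightarrow> free_alg set"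
  where "serre_relations l q a d c =
    {serre_element q a d c i j | i j. i \<in> {1..l} \<and> j \<in> {1..l} \<and> i \<noteq> j}"

definition F_algebra ::
    "nat \<Rightarrow> complex \<Rightarrow> (nat \<Rightarrow> nat \<Rightarrow> int) \<Rightarrow> (nat \<Rightarrow> nat) \<Rightarrow> (nat \<Rightarrow> nat \<Rightarrow> complex) \<Rightarrow>
      (complex, free_alg set) module"
  where "F_algebra l q a d c = presented_algebra l (serre_relations l q a d c)"

definition F_generator ::
    "nat \<Rightarrow> complex \<Rightarrow> (nat \<Rightarrow> nat \<Rightarrow> int) \<Rightarrow> (nat \<Rightarrow> nat) \<Rightarrow> (nat \<Rightarrow> nat \<Rightarrow> complex) \<Rightarrow> nat \<Rightarrow> free_alg set"
  where "F_generator l q a d c i = quotient_class l (serre_relations l q a d c) (generator i)"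

end

theory Submission
  imports Defs
begin

text \<open>
  A character that sends every generator to \<open>1\<close> can only be the one induced by the augmentation of
  the free algebra (the sum of all coefficients), and the augmentation descends to the quotient
  exactly if it kills the relations.  So the whole statement reduces to the vanishing of the scalars
  \<open>\<Sum>r (-1)^r q^(r c i j) [1 - a i j, r]\<close>, where the bracket is the quantum binomial coefficient at
  \<open>t = q^(d i)\<close>; see \<open>ex1_character_presented_algebra\<close> and \<open>augmentation_serre_element\<close>.

  Write \<open>n = - a i j\<close>.  By the \<open>q\<close>-binomial theorem,
  \<open>\<Sum>r (-1)^r z^r [n + 1, r] = \<Prod>p=0..n. (1 - t^(n - 2 p) z)\<close>, which has the roots
  \<open>z = t^n\<close> and \<open>z = t^(-n)\<close>.  For these two values of \<open>z\<close> the sum telescopes by the \<open>q\<close>-Pascal rule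
  (\<open>alternating_q_binomial_sum\<close>); the second case is the first one at \<open>1 / t\<close>.  It remains to see that
  \<open>q^(c i j)\<close> is one of them, that is, \<open>c i j = d i * a i j\<close> or \<open>c i j = - d i * a i j\<close>, and that
  \<open>a i j\<close> is nonpositive for \<open>i \<noteq> j\<close>, so that \<open>n\<close> is a natural number.

  The value of \<open>c i j\<close> comes from an explicit preimage of \<open>\<alpha> i\<close> under \<open>1 - s\<close>.  If the products of
  \<open>v\<close> with the simple roots are prescribed suitably, then the reflections to the right of \<open>s i\<close> fix \<open>v\<close>,
  \<open>s i\<close> sends \<open>v\<close> to \<open>v - \<alpha> i\<close>, and the reflections to the left fix \<open>v - \<alpha> i\<close>.  Hence
  \<open>v - s v = \<alpha> i\<close> and the Cayley transform of \<open>\<alpha> i\<close> is \<open>2 v - \<alpha> i\<close>, whose product with \<open>\<alpha> j\<close> is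
  \<open>B (\<alpha> i) (\<alpha> j)\<close> up to a sign that tells which of \<open>s i\<close>, \<open>s j\<close> stands further left
  (\<open>coxeter_coeff_eq_plus_or_minus_form\<close>).  Both the existence of \<open>v\<close> and the injectivity of \<open>1 - s\<close>
  rest on the nondegeneracy of \<open>B\<close>.

  The two facts about the Cartan matrix are derived from the Lie algebra.  A nonzero vector of the
  root space of \<open>\<alpha> j\<close> is annihilated by the root space of \<open>- \<alpha> i\<close>, because \<open>\<alpha> j - \<alpha> i\<close> is not a root;
  it is thus a lowest weight vector of weight \<open>a i j\<close> for the sl2-triple of \<open>\<alpha> i\<close>, and in finite
  dimension such a weight is nonpositive (\<open>cartan_off_diagonal\<close>).  For the nondegeneracy
  (\<open>coroots_separate\<close>) one uses the Killing form: by invariance it pairs the coroot of \<open>\<alpha> i\<close> with the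
  Cartan subalgebra by a multiple of \<open>\<alpha> i\<close>, and it is positive semidefinite on real combinations of
  coroots, because in a simultaneous eigenbasis their eigenvalues are real.
\<close>

section \<open>Alternating sums of quantum binomial coefficients\<close>

lemma q_int_inverse: "q_int (inverse t) n = q_int t n"
  unfolding q_int_def by (metis inverse_inverse_eq minus_diff_eq minus_divide_divide)

lemma q_binomial_inverse: "q_binomial (inverse t) m n = q_binomial t m n"
  by (simp add: q_binomial_def q_fact_def q_int_inverse)

lemma q_int_nonzero:
  assumes "0 < norm t" "norm t < 1" "n > 0"
  shows "q_int t n \<noteq> 0"
proof -
  have neq: "t ^ k \<noteq> inverse t ^ k" if "k > 0" for k
  proof
    assume "t ^ k = inverse t ^ k"
    then have "norm t ^ k = inverse (norm t) ^ k"
      by (metis norm_inverse norm_power)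
    moreover have "norm t ^ k < 1"
      using assms that by (simp add: power_less_one_iff)
    moreover have "inverse (norm t) ^ k \<ge> 1"
      using assms by (intro one_le_power) (simp add: one_le_inverse)
    ultimately show False by simp
  qed
  show ?thesis
    using neq[of n] neq[of 1] assms by (simp add: q_int_def)
qed

text \<open>The two halves of \<open>t^(m + n) - t^(-m - n)\<close> after inserting \<open>\<plusminus> t^(n - m)\<close>.  This is all that the
  \<open>q\<close>-Pascal rule says once the common factorials are cleared.\<close>
lemma q_int_add:
  assumes "t \<noteq> 0"
  shows "q_int t (m + n) = t ^ n * q_int t m + inverse t ^ m * q_int t n"
proof -
  have "t ^ (m + n) - inverse t ^ (m + n) =
      t ^ n * (t ^ m - inverse t ^ m) + inverse t ^ m * (t ^ n - inverse t ^ n)"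
    using assms by (simp add: power_add algebra_simps flip: power_mult_distrib)
  then show ?thesis
    by (simp add: q_int_def flip: add_divide_distrib)
qed

lemma q_fact_Suc: "q_fact t (Suc n) = q_int t (Suc n) * q_fact t n"
  by (simp add: q_fact_def)

text \<open>From here on the genericity of \<open>t\<close> is the condition that no quantum integer vanishes.  Unlike
  \<open>norm t < 1\<close> it is symmetric under \<open>t \<mapsto> 1 / t\<close>, so that the results also apply to \<open>1 / t\<close>.\<close>
lemma q_fact_nonzero:
  assumes "\<forall>k>0. q_int t k \<noteq> 0"
  shows "q_fact t n \<noteq> 0"
  using assms by (auto simp: q_fact_def)

lemma q_binomial_0:
  assumes "\<forall>k>0. q_int t k \<noteq> 0"
  shows "q_binomial t n 0 = 1"
  using q_fact_nonzero[OF assms] by (simp add: q_binomial_def) (simp add: q_fact_def)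

lemma q_binomial_self:
  assumes "\<forall>k>0. q_int t k \<noteq> 0"
  shows "q_binomial t n n = 1"
  using q_fact_nonzero[OF assms] by (simp add: q_binomial_def) (simp add: q_fact_def)

lemma q_pascal:
  assumes t: "\<forall>k>0. q_int t k \<noteq> 0" and r: "Suc r \<le> n"
  shows "q_binomial t (Suc n) (Suc r) =
    t ^ Suc r * q_binomial t n (Suc r) + inverse t ^ (n - r) * q_binomial t n r"
proof -
  obtain k where n: "n = Suc (r + k)"
    using r by (metis add_Suc less_eqE)
  have t0: "t \<noteq> 0" using t by (auto simp: q_int_def)
  have split: "q_int t (Suc n) = t ^ Suc r * q_int t (Suc k) + inverse t ^ Suc k * q_int t (Suc r)"
    using q_int_add[OF t0, of "Suc k" "Suc r"] by (simp add: n add.commute)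
  have nz: "q_fact t r \<noteq> 0" "q_fact t k \<noteq> 0" "q_int t (Suc r) \<noteq> 0" "q_int t (Suc k) \<noteq> 0"
    using t by (simp_all add: q_fact_nonzero)
  have e: "Suc n - Suc r = Suc k" "n - Suc r = k" "n - r = Suc k" by (auto simp: n)
  have "q_binomial t (Suc n) (Suc r) = q_int t (Suc n) * q_fact t n /
      (q_int t (Suc r) * q_int t (Suc k) * q_fact t r * q_fact t k)"
    by (simp add: q_binomial_def e q_fact_Suc)
  also have "\<dots> = t ^ Suc r * (q_fact t n / (q_int t (Suc r) * q_fact t r * q_fact t k)) +
      inverse t ^ Suc k * (q_fact t n / (q_fact t r * (q_int t (Suc k) * q_fact t k)))"
    unfolding split using nz by (simp add: field_simps)
  finally show ?thesis
    by (simp only: q_binomial_def e q_fact_Suc)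
qed

text \<open>By the \<open>q\<close>-Pascal rule the summand is \<open>G r - G (r - 1)\<close> for
  \<open>G r = (-1)^r t^(r (n + 1)) [n, r]\<close>.  The last summand \<open>r = n + 1\<close> is excluded, because
  the definition of the quantum binomial coefficient uses truncated subtraction and does not yield
  zero for \<open>[n, n + 1]\<close>.\<close>
lemma alternating_q_binomial_partial_sum:
  assumes t: "\<forall>k>0. q_int t k \<noteq> 0" and "k \<le> n"
  shows "(\<Sum>r=0..k. (- 1) ^ r * t ^ (r * n) * q_binomial t (Suc n) r) =
    (- 1) ^ k * t ^ (k * Suc n) * q_binomial t n k"
  using \<open>k \<le> n\<close>
proof (induction k)
  case 0
  then show ?case by (simp add: q_binomial_0[OF t])
next
  case (Suc k)
  have t0: "t \<noteq> 0" using t by (auto simp: q_int_def)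
  \<comment> \<open>the exponents of \<open>t\<close> in the part of the new summand that cancels \<open>G k\<close>\<close>
  have e: "t ^ (Suc k * n) * inverse t ^ (n - k) = t ^ (k * Suc n)"
  proof -
    have "Suc k * n = k * Suc n + (n - k)" using Suc.prems by simp
    then have "t ^ (Suc k * n) = t ^ (k * Suc n) * t ^ (n - k)"
      by (metis power_add)
    then show ?thesis using t0 by (simp flip: power_mult_distrib)
  qed
  have "(\<Sum>r=0..Suc k. (- 1) ^ r * t ^ (r * n) * q_binomial t (Suc n) r) =
     (- 1) ^ k * t ^ (k * Suc n) * q_binomial t n k +
     (- 1) ^ Suc k * t ^ (Suc k * n) * q_binomial t (Suc n) (Suc k)"
    using Suc by (simp add: sum.atLeast0_atMost_Suc)
  also have "(- 1) ^ Suc k * t ^ (Suc k * n) * q_binomial t (Suc n) (Suc k) =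
      (- 1) ^ Suc k * (t ^ (Suc k * n) * t ^ Suc k) * q_binomial t n (Suc k) +
      (- 1) ^ Suc k * (t ^ (Suc k * n) * inverse t ^ (n - k)) * q_binomial t n k"
    unfolding q_pascal[OF t Suc.prems] by (simp only: distrib_left mult.assoc)
  finally show ?case
    unfolding e by (simp add: power_add mult.assoc)
qed

text \<open>The value at \<open>z = t^n\<close> of the polynomial \<open>\<Prod>p=0..n. (1 - t^(n - 2 p) z)\<close>, whose factor \<open>p = n\<close> vanishes
  there.\<close>
lemma alternating_q_binomial_sum:
  assumes t: "\<forall>k>0. q_int t k \<noteq> 0"
  shows "(\<Sum>r=0..Suc n. (- 1) ^ r * t ^ (r * n) * q_binomial t (Suc n) r) = 0"
proof -
  have "t ^ (n * Suc n) = t ^ (Suc n * n)"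
    by (simp only: mult.commute)
  then show ?thesis
    unfolding sum.atLeast0_atMost_Suc alternating_q_binomial_partial_sum[OF t order_refl]
    by (simp only: q_binomial_self[OF t]) simp
qed

section \<open>Linear independence of indexed families\<close>

lemma sum_fun_apply: "(\<Sum>i\<in>A. f i) x = (\<Sum>i\<in>A. f i x)"
  for f :: "'b \<Rightarrow> 'a \<Rightarrow> 'c::comm_monoid_add"
  by (induction A rule: infinite_finite_induct) auto

text \<open>Bases occur below as families indexed by \<open>{1..l}\<close>, whereas \<open>independent\<close> speaks about sets; this
  translates once and for all, with injectivity of the indexing as part of independence.\<close>
lemma (in vector_space) independent_family_iff:
  assumes "finite I"
  shows "inj_on f I \<and> independent (f ` I) \<longleftrightarrow>
    (\<forall>x. (\<Sum>i\<in>I. scale (x i) (f i)) = 0 \<longrightarrow> (\<forall>i\<in>I. x i = 0))"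
proof (intro iffI conjI allI impI)
  fix x assume f: "inj_on f I \<and> independent (f ` I)"
    and "(\<Sum>i\<in>I. scale (x i) (f i)) = 0"
  then have "(\<Sum>v\<in>f ` I. scale (x (the_inv_into I f v)) v) = 0"
    by (subst sum.reindex) (auto simp: the_inv_into_f_f)
  then have "\<forall>v\<in>f ` I. x (the_inv_into I f v) = 0"
    using f dependent_finite[of "f ` I"] assms by auto
  then show "\<forall>i\<in>I. x i = 0"
    using f by (auto simp: the_inv_into_f_f)
next
  assume zero: "\<forall>x. (\<Sum>i\<in>I. scale (x i) (f i)) = 0 \<longrightarrow> (\<forall>i\<in>I. x i = 0)"
  show inj: "inj_on f I"
  proof (rule inj_onI, rule ccontr)
    fix i j assume ij: "i \<in> I" "j \<in> I" "f i = f j" "i \<noteq> j"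
    have "(\<Sum>k\<in>I. scale (if k = i then 1 else if k = j then - 1 else 0) (f k)) =
        (\<Sum>k\<in>{i, j}. scale (if k = i then 1 else if k = j then - 1 else 0) (f k))"
      using ij assms by (intro sum.mono_neutral_right) auto
    also have "\<dots> = 0"
      using ij by simp
    finally show False
      using zero ij by fastforce
  qed
  show "independent (f ` I)"
    unfolding dependent_finite[OF finite_imageI[OF assms]]
    using zero by (auto simp: sum.reindex[OF inj])
qed

text \<open>Applying \<open>T - c j\<close> to a vanishing sum removes the summand with index \<open>j\<close> and multiplies the others by
  the nonzero factors \<open>c i - c j\<close>.\<close>
lemma (in vector_space) eigenvector_sum_eq_zero:
  assumes T: "Vector_Spaces.linear scale scale T" and "finite I" "inj_on c I"
    and "\<And>i. i \<in> I \<Longrightarrow> T (v i) = scale (c i) (v i)" and "(\<Sum>i\<in>I. v i) = 0"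
  shows "\<forall>i\<in>I. v i = 0"
  using assms(2-5)
proof (induction I arbitrary: v)
  case (insert j I)
  interpret T: Vector_Spaces.linear scale scale T by (rule T)
  let ?w = "\<lambda>i. scale (c i - c j) (v i)"
  have total: "v j + (\<Sum>i\<in>I. v i) = 0"
    using insert by simp
  have "(\<Sum>i\<in>I. ?w i) = (\<Sum>i\<in>I. T (v i)) - scale (c j) (\<Sum>i\<in>I. v i)"
    using insert.prems(2) by (simp add: scale_left_diff_distrib sum_subtractf scale_sum_right)
  also have "\<dots> = T (v j + (\<Sum>i\<in>I. v i)) - scale (c j) (v j + (\<Sum>i\<in>I. v i))"
    using insert.prems(2) by (simp add: T.add T.sum scale_right_distrib)
  also have "\<dots> = 0"
    by (simp add: total T.zero)
  finally have "\<forall>i\<in>I. ?w i = 0"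
    using insert.prems by (intro insert.IH) (auto simp: T.scale inj_on_def mult.commute)
  then have "\<forall>i\<in>I. v i = 0"
    using insert.prems(1) insert.hyps(2) by (auto simp: inj_on_def)
  with total show ?case by simp
qed simp

lemma (in vector_space) eigenvectors_independent:
  assumes T: "Vector_Spaces.linear scale scale T" and I: "finite I" "inj_on c I"
    and eigen: "\<And>i. i \<in> I \<Longrightarrow> T (v i) = scale (c i) (v i)" "\<And>i. i \<in> I \<Longrightarrow> v i \<noteq> 0"
  shows "inj_on v I \<and> independent (v ` I)"
  unfolding independent_family_iff[OF I(1)]
proof (intro allI impI)
  interpret T: Vector_Spaces.linear scale scale T by (rule T)
  fix x assume zero: "(\<Sum>i\<in>I. scale (x i) (v i)) = 0"
  have "\<forall>i\<in>I. scale (x i) (v i) = 0"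
    by (rule eigenvector_sum_eq_zero[OF T I _ zero]) (simp add: T.scale eigen(1) mult.commute)
  then show "\<forall>i\<in>I. x i = 0"
    using eigen(2) by auto
qed

text \<open>Rows without a linear relation are independent, and there are as many of them as unit vectors, so they
  span.  The count is the exchange lemma \<open>independent_span_bound\<close>, applied to rows and unit vectors
  as functions that vanish outside \<open>I\<close>.\<close>
lemma square_system_solvable:
  fixes M :: "'i \<Rightarrow> 'i \<Rightarrow> complex"
  assumes I: "finite I"
    and kernel: "\<And>x. \<forall>k\<in>I. (\<Sum>j\<in>I. x j * M j k) = 0 \<Longrightarrow> \<forall>j\<in>I. x j = 0"
  shows "\<exists>x. \<forall>k\<in>I. (\<Sum>j\<in>I. x j * M j k) = r k"
proof -
  define row where "row j = (\<lambda>k. if k \<in> I then M j k else 0)" for j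
  define e :: "'i \<Rightarrow> 'i \<Rightarrow> complex" where "e k = (\<lambda>m. if m = k then 1 else 0)" for k
  have in_span: "(\<lambda>k. if k \<in> I then s k else 0) \<in> functional.span (e ` I)" for s
  proof -
    have "(\<lambda>k. if k \<in> I then s k else 0) = (\<Sum>k\<in>I. fun_scale (s k) (e k))"
      using I by (auto simp: fun_eq_iff sum_fun_apply fun_scale_def e_def
          if_distrib[of "times _"] cong: if_cong)
    moreover have "\<dots> \<in> functional.span (e ` I)"
      by (intro functional.span_sum functional.span_scale functional.span_base imageI)
    ultimately show ?thesis
      by simp
  qed
  have "\<forall>x. (\<Sum>j\<in>I. fun_scale (x j) (row j)) = 0 \<longrightarrow> (\<forall>j\<in>I. x j = 0)"
  proof (intro allI impI)
    fix x assume zero: "(\<Sum>j\<in>I. fun_scale (x j) (row j)) = 0"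
    have eval: "(\<Sum>j\<in>I. x j * M j k) = (\<Sum>j\<in>I. fun_scale (x j) (row j)) k" if "k \<in> I" for k
      using that by (simp add: sum_fun_apply fun_scale_def row_def)
    show "\<forall>j\<in>I. x j = 0"
      by (rule kernel) (simp add: eval zero)
  qed
  then have inj: "inj_on row I" and indep: "functional.independent (row ` I)"
    using functional.independent_family_iff[OF I, of row] by auto
  define \<rho> where "\<rho> = (\<lambda>k. if k \<in> I then r k else 0)"
  have "\<rho> \<in> functional.span (row ` I)"
  proof (rule ccontr)
    assume notin: "\<rho> \<notin> functional.span (row ` I)"
    have "card (insert \<rho> (row ` I)) \<le> card (e ` I)"
      using functional.independent_span_bound[of "e ` I" "insert \<rho> (row ` I)"] I
        functional.independent_insertI[OF notin indep] in_span
      by (auto simp: row_def \<rho>_def)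
    also have "\<dots> \<le> card I"
      using I by (rule card_image_le)
    finally have "card (insert \<rho> (row ` I)) \<le> card I" .
    moreover have "\<rho> \<notin> row ` I"
      using notin functional.span_base by blast
    then have "card (insert \<rho> (row ` I)) = Suc (card I)"
      using I by (simp add: card_image[OF inj])
    ultimately show False by simp
  qed
  then obtain y where "\<rho> = (\<Sum>v\<in>row ` I. fun_scale (y v) v)"
    using I by (auto simp: functional.span_finite)
  then have y: "\<rho> = (\<Sum>j\<in>I. fun_scale (y (row j)) (row j))"
    by (simp add: sum.reindex[OF inj])
  have "(\<Sum>j\<in>I. y (row j) * M j k) = r k" if "k \<in> I" for k
    using fun_cong[OF y, of k] that by (simp add: sum_fun_apply fun_scale_def \<rho>_def row_def)
  then show ?thesis by (intro exI[of _ "\<lambda>j. y (row j)"]) simp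
qed

section \<open>The Cayley transform of a Coxeter element\<close>

lemma bilinear_form_on_sum:
  assumes B: "bilinear_form_on V B" and V: "functional.subspace V"
    and "\<And>i. i \<in> A \<Longrightarrow> f i \<in> V" "z \<in> V"
  shows "B (\<Sum>i\<in>A. fun_scale (x i) (f i)) z = (\<Sum>i\<in>A. x i * B (f i) z)"
proof -
  have add: "B (v + w) z = B v z + B w z" if "v \<in> V" "w \<in> V" for v w
    using B \<open>z \<in> V\<close> that by (simp add: bilinear_form_on_def)
  have scale: "B (fun_scale k v) z = k * B v z" if "v \<in> V" for k v
    using B \<open>z \<in> V\<close> that by (simp add: bilinear_form_on_def)
  have zero: "B 0 z = 0"
    using scale[OF \<open>z \<in> V\<close>, of 0] by simp
  show ?thesis
    using assms(3)
  proof (induction A rule: infinite_finite_induct)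
    case (insert i A)
    then have "fun_scale (x i) (f i) \<in> V" "(\<Sum>i\<in>A. fun_scale (x i) (f i)) \<in> V"
      by (auto intro!: functional.subspace_sum[OF V] functional.subspace_scale[OF V])
    then have "B (fun_scale (x i) (f i) + (\<Sum>i\<in>A. fun_scale (x i) (f i))) z =
        x i * B (f i) z + B (\<Sum>i\<in>A. fun_scale (x i) (f i)) z"
      using insert.prems by (simp only: add scale insertI1)
    moreover have "B (\<Sum>i\<in>A. fun_scale (x i) (f i)) z = (\<Sum>i\<in>A. x i * B (f i) z)"
      using insert.prems by (intro insert.IH) simp
    ultimately show ?case by (simp only: sum.insert[OF insert.hyps])
  qed (simp_all add: zero)
qed

text \<open>The data from which \<open>1 - s\<close> is inverted, for a Coxeter element \<open>s\<close> of the reflections in a basis.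
  Nondegeneracy is required against the basis vectors, where it becomes a statement about coroots.\<close>
locale nondegenerate_form =
  fixes V :: "('g \<Rightarrow> complex) set"
    and B :: "('g \<Rightarrow> complex) \<Rightarrow> ('g \<Rightarrow> complex) \<Rightarrow> complex"
    and \<alpha> :: "nat \<Rightarrow> 'g \<Rightarrow> complex"
    and l :: nat
  assumes bilinear: "bilinear_form_on V B"
    and inj: "inj_on \<alpha> {1..l}"
    and independent: "functional.independent (\<alpha> ` {1..l})"
    and span: "functional.span (\<alpha> ` {1..l}) = V"
    and anisotropic: "i \<in> {1..l} \<Longrightarrow> B (\<alpha> i) (\<alpha> i) \<noteq> 0"
    and nondegenerate: "\<lbrakk>v \<in> V; \<forall>i\<in>{1..l}. B v (\<alpha> i) = 0\<rbrakk> \<Longrightarrow> v = 0"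
begin

lemma subspace: "functional.subspace V"
  by (metis span functional.subspace_span)

lemma basis_in: "i \<in> {1..l} \<Longrightarrow> \<alpha> i \<in> V"
  by (metis span functional.span_base imageI)

lemma scale_in: "v \<in> V \<Longrightarrow> fun_scale x v \<in> V"
  by (rule functional.subspace_scale[OF subspace])

lemma diff_in: "\<lbrakk>v \<in> V; w \<in> V\<rbrakk> \<Longrightarrow> v - w \<in> V"
  by (rule functional.subspace_diff[OF subspace])

lemma sum_in: "(\<And>i. i \<in> A \<Longrightarrow> f i \<in> V) \<Longrightarrow> (\<Sum>i\<in>A. f i) \<in> V"
  by (rule functional.subspace_sum[OF subspace])

lemma form_add: "\<lbrakk>x \<in> V; y \<in> V; z \<in> V\<rbrakk> \<Longrightarrow> B (x + y) z = B x z + B y z"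
  using bilinear by (simp add: bilinear_form_on_def)

lemma form_diff: "\<lbrakk>x \<in> V; y \<in> V; z \<in> V\<rbrakk> \<Longrightarrow> B (x - y) z = B x z - B y z"
  using form_add[of "x - y" y z] by (simp add: diff_in)

lemma vector_with_prescribed_products:
  "\<exists>v\<in>V. \<forall>k\<in>{1..l}. B v (\<alpha> k) = r k"
proof -
  let ?comb = "\<lambda>x. \<Sum>j\<in>{1..l}. fun_scale (x j) (\<alpha> j)"
  have comb: "?comb x \<in> V" for x
    by (intro sum_in scale_in basis_in)
  have form: "B (?comb x) (\<alpha> k) = (\<Sum>j\<in>{1..l}. x j * B (\<alpha> j) (\<alpha> k))" if "k \<in> {1..l}" for x k
    using that by (intro bilinear_form_on_sum[OF bilinear subspace] basis_in)
  have "\<exists>x. \<forall>k\<in>{1..l}. (\<Sum>j\<in>{1..l}. x j * B (\<alpha> j) (\<alpha> k)) = r k"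
  proof (rule square_system_solvable)
    fix x assume "\<forall>k\<in>{1..l}. (\<Sum>j\<in>{1..l}. x j * B (\<alpha> j) (\<alpha> k)) = 0"
    then have "?comb x = 0"
      by (intro nondegenerate[OF comb] ballI) (simp only: form)
    then show "\<forall>j\<in>{1..l}. x j = 0"
      using functional.independent_family_iff[of "{1..l}" \<alpha>] inj independent by blast
  qed simp
  then obtain x where "\<forall>k\<in>{1..l}. (\<Sum>j\<in>{1..l}. x j * B (\<alpha> j) (\<alpha> k)) = r k" ..
  then show ?thesis
    by (intro bexI[OF _ comb[of x]] ballI) (simp only: form)
qed

text \<open>Words in the simple reflections as lists of indices, so that a Coxeter element can be split at the
  position of a given reflection.\<close>
definition reflections :: "nat list \<Rightarrow> ('g \<Rightarrow> complex) \<Rightarrow> ('g \<Rightarrow> complex)"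
  where "reflections js = foldr (\<lambda>j f. reflection B (\<alpha> j) \<circ> f) js id"

lemma reflections_simps [simp]:
  "reflections [] v = v"
  "reflections (j # js) v = reflection B (\<alpha> j) (reflections js v)"
  by (simp_all add: reflections_def)

lemma reflections_append: "reflections (is @ js) v = reflections is (reflections js v)"
  by (induction "is") auto

lemma coxeter_element_eq: "coxeter_element B \<alpha> l \<pi> = reflections (map \<pi> [1..<Suc l])"
  unfolding coxeter_element_def reflections_def by (simp only: foldr_map comp_def)

lemma reflections_in:
  "\<lbrakk>v \<in> V; set js \<subseteq> {1..l}\<rbrakk> \<Longrightarrow> reflections js v \<in> V"
  by (induction js) (auto simp: reflection_def intro!: diff_in scale_in basis_in)

lemma reflections_diff:
  "\<lbrakk>v \<in> V; w \<in> V; set js \<subseteq> {1..l}\<rbrakk> \<Longrightarrow>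
    reflections js (v - w) = reflections js v - reflections js w"
proof (induction js)
  case (Cons j js)
  then have "reflections js v \<in> V" "reflections js w \<in> V" "\<alpha> j \<in> V"
    by (auto simp: reflections_in basis_in)
  moreover have "reflections js (v - w) = reflections js v - reflections js w"
    using Cons.prems by (intro Cons.IH) auto
  ultimately show ?case
    by (simp only: reflections_simps reflection_def form_diff right_diff_distrib diff_divide_distrib
        functional.scale_left_diff_distrib) (simp only: algebra_simps)
qed simp

lemma reflections_fixed:
  "\<forall>j\<in>set js. B v (\<alpha> j) = 0 \<Longrightarrow> reflections js v = v"
  by (induction js) (auto simp: reflection_def)

text \<open>The coefficient \<open>x j\<close> is the multiple of \<open>\<alpha> j\<close> that the reflection in \<open>\<alpha> j\<close> subtracts.  If all of
  them vanish, no reflection has moved the vector, so each coefficient is computed from \<open>v\<close> itself and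
  \<open>v\<close> is orthogonal to all \<open>\<alpha> j\<close>.\<close>
lemma reflections_expansion:
  assumes "v \<in> V" "set js \<subseteq> {1..l}" "distinct js"
  shows "\<exists>x. reflections js v = v - (\<Sum>j\<in>set js. fun_scale (x j) (\<alpha> j)) \<and>
    ((\<forall>j\<in>set js. x j = 0) \<longrightarrow> (\<forall>j\<in>set js. B v (\<alpha> j) = 0))"
  using assms(2,3)
proof (induction js)
  case (Cons j js)
  have "set js \<subseteq> {1..l}" "distinct js" using Cons.prems by auto
  from Cons.IH[OF this] obtain x where x: "reflections js v = v - (\<Sum>k\<in>set js. fun_scale (x k) (\<alpha> k))"
    and zero: "(\<forall>k\<in>set js. x k = 0) \<longrightarrow> (\<forall>k\<in>set js. B v (\<alpha> k) = 0)"
    by blast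
  define t where "t = 2 * B (reflections js v) (\<alpha> j) / B (\<alpha> j) (\<alpha> j)"
  let ?x = "x(j := t)"
  have j: "j \<in> {1..l}" "j \<notin> set js" using Cons.prems by auto
  have "(\<Sum>k\<in>set js. fun_scale (?x k) (\<alpha> k)) = (\<Sum>k\<in>set js. fun_scale (x k) (\<alpha> k))"
    using j by (intro sum.cong) auto
  then have "reflections (j # js) v = v - (\<Sum>k\<in>set (j # js). fun_scale (?x k) (\<alpha> k))"
    using j by (simp add: reflection_def flip: t_def) (simp add: x algebra_simps)
  moreover have "\<forall>k\<in>set (j # js). B v (\<alpha> k) = 0" if x0: "\<forall>k\<in>set (j # js). ?x k = 0"
  proof -
    have "\<forall>k\<in>set js. x k = 0" using x0 j by (metis fun_upd_other list.set_intros(2))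
    with x zero have "reflections js v = v" "\<forall>k\<in>set js. B v (\<alpha> k) = 0"
      by (auto simp: fun_scale_def fun_eq_iff sum_fun_apply)
    moreover have "B v (\<alpha> j) = 0"
      using x0 \<open>reflections js v = v\<close> anisotropic[OF j(1)] by (auto simp: t_def)
    ultimately show ?thesis by auto
  qed
  ultimately show ?case by (intro exI[of _ ?x]) blast
qed auto

text \<open>A vector fixed by a product of all simple reflections, each used once, is fixed by every single one:
  the multiples of the simple roots that are subtracted on the way are linearly independent and add
  up to zero.\<close>
lemma inj_on_one_minus_reflections:
  assumes js: "set js = {1..l}" "distinct js"
  shows "inj_on (\<lambda>v. v - reflections js v) V"
proof (rule inj_onI)
  fix v w assume vw: "v \<in> V" "w \<in> V" "v - reflections js v = w - reflections js w"
  have u: "v - w \<in> V" using vw by (simp add: diff_in)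
  have fixed: "reflections js (v - w) = v - w"
    using vw js by (simp add: reflections_diff algebra_simps)
  obtain x where x: "reflections js (v - w) = (v - w) - (\<Sum>j\<in>{1..l}. fun_scale (x j) (\<alpha> j))"
    and zero: "(\<forall>j\<in>{1..l}. x j = 0) \<longrightarrow> (\<forall>j\<in>{1..l}. B (v - w) (\<alpha> j) = 0)"
    using reflections_expansion[OF u _ js(2)] js(1) by auto
  have "(\<Sum>j\<in>{1..l}. fun_scale (x j) (\<alpha> j)) = 0"
    using x unfolding fixed by (metis add_cancel_left_right diff_add_cancel)
  then have "\<forall>j\<in>{1..l}. x j = 0"
    using functional.independent_family_iff[of "{1..l}" \<alpha>] inj independent by blast
  then have "v - w = 0"
    using nondegenerate[OF u] zero by blast
  then show "v = w" by simp
qed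

text \<open>The sign is positive exactly if \<open>s j\<close> stands to the left of \<open>s i\<close> in the Coxeter element.\<close>
lemma coxeter_coeff_eq_plus_or_minus_form:
  assumes \<pi>: "\<pi> permutes {1..l}" and i: "i \<in> {1..l}" and j: "j \<in> {1..l}" and neq: "i \<noteq> j"
  shows "coxeter_coeff V B \<alpha> l \<pi> i j \<in> {B (\<alpha> i) (\<alpha> j), - B (\<alpha> i) (\<alpha> j)}"
proof -
  define js where "js = map \<pi> [1..<Suc l]"
  have js: "set js = {1..l}" "distinct js"
    using permutes_image[OF \<pi>] permutes_inj_on[OF \<pi>]
    by (simp_all add: js_def distinct_map atLeastLessThanSuc_atLeastAtMost del: upt_Suc)
  obtain xs ys where split: "js = xs @ i # ys"
    using i js(1) by (metis split_list)
  then have i_notin: "i \<notin> set xs" "i \<notin> set ys" and sub: "set xs \<subseteq> {1..l}" "set ys \<subseteq> {1..l}"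
    and disj: "set xs \<inter> set ys = {}"
    using js by auto
  \<comment> \<open>\<open>v\<close> is orthogonal to the roots that act before \<open>s i\<close>, and \<open>v - \<alpha> i\<close> to those that act after it\<close>
  obtain v where v: "v \<in> V" and prod: "\<forall>k\<in>{1..l}. B v (\<alpha> k) =
      (if k = i then B (\<alpha> i) (\<alpha> i) / 2 else if k \<in> set xs then B (\<alpha> i) (\<alpha> k) else 0)"
    using vector_with_prescribed_products[of "\<lambda>k. if k = i then B (\<alpha> i) (\<alpha> i) / 2
      else if k \<in> set xs then B (\<alpha> i) (\<alpha> k) else 0"] by blast
  have "reflections ys v = v"
    using prod sub i_notin disj by (intro reflections_fixed) (auto simp: subset_iff)
  moreover have "reflection B (\<alpha> i) v = v - \<alpha> i"
    using prod i anisotropic[OF i] by (simp add: reflection_def fun_scale_def)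
  moreover have "reflections xs (v - \<alpha> i) = v - \<alpha> i"
    using prod sub i_notin v i
    by (intro reflections_fixed) (auto simp: form_diff basis_in subset_iff)
  ultimately have s: "reflections js v = v - \<alpha> i"
    by (simp add: split reflections_append)
  have "inv_into V (\<lambda>v. v - reflections js v) (\<alpha> i) = v"
    using inv_into_f_f[OF inj_on_one_minus_reflections[OF js] v] by (simp add: s)
  then have "coxeter_coeff V B \<alpha> l \<pi> i j = B (v + (v - \<alpha> i)) (\<alpha> j)"
    by (simp only: coxeter_coeff_def cayley_transform_def coxeter_element_eq s Let_def flip: js_def)
  also have "\<dots> = 2 * B v (\<alpha> j) - B (\<alpha> i) (\<alpha> j)"
    using v i j by (simp only: form_add form_diff diff_in basis_in) simp
  finally show ?thesis
    using prod j neq by auto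
qed

end

section \<open>Weight vectors in a complex Lie algebra\<close>

context complex_lie_algebra
begin

lemma br_add_right: "br x (y + z) = br x y + br x z"
  and br_scale_right: "br x (sc a y) = sc a (br x y)"
  and br_add_left: "br (x + y) z = br x z + br y z"
  and br_scale_left: "br (sc a x) z = sc a (br x z)"
  using br_linear_right[of x] br_linear_left[of z] by (auto simp: Vector_Spaces.linear_iff)

lemma br_zero_right: "br x 0 = 0"
  using br_add_right[of x 0 0] by simp

lemma br_zero_left: "br 0 x = 0"
  using br_add_left[of 0 0 x] by simp

lemma br_minus_right: "br x (- y) = - br x y"
  using br_add_right[of x y "- y"] by (simp add: br_zero_right minus_unique)

lemma br_minus_left: "br (- x) y = - br x y"
  using br_add_left[of x "- x" y] by (simp add: br_zero_left minus_unique)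

lemma br_diff_right: "br x (y - z) = br x y - br x z"
  using br_add_right[of x y "- z"] by (simp add: br_minus_right)

lemma br_sum_right: "br x (\<Sum>i\<in>A. f i) = (\<Sum>i\<in>A. br x (f i))"
  by (induction A rule: infinite_finite_induct) (auto simp: br_zero_right br_add_right)

lemma br_antisym: "br y x = - br x y"
proof -
  have "br (x + y) (x + y) = br x y + br y x"
    by (simp add: br_add_left br_add_right br_self[of x] br_self[of y] add.commute)
  then have "br y x + br x y = 0"
    using br_self[of "x + y"] by (simp add: add.commute)
  then show ?thesis
    by (simp only: eq_neg_iff_add_eq_0)
qed

text \<open>The Jacobi identity in the form that is used everywhere: \<open>br x\<close> is a derivation.\<close>
lemma br_derivation: "br x (br y z) = br (br x y) z + br y (br x z)"
proof -
  have "br y (br z x) = - br y (br x z)"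
    by (metis br_antisym br_minus_right)
  moreover have "br z (br x y) = - br (br x y) z"
    by (rule br_antisym)
  ultimately show ?thesis
    using jacobi[of x y z] by (simp add: algebra_simps)
qed

lemma root_space_br:
  assumes "x \<in> root_space h f" "y \<in> root_space h g"
  shows "br x y \<in> root_space h (f + g)"
  using assms
  by (auto simp: root_space_def br_derivation[of _ x y] br_scale_left br_scale_right scale_left_distrib)

text \<open>Raising \<open>v\<close> by \<open>e\<close> gives vectors of weights \<open>m\<close>, \<open>m + 2\<close>, \<open>m + 4\<close>, and so on, and lowering the vector
  number \<open>n + 1\<close> by \<open>f\<close> multiplies its predecessor by \<open>- (n + 1) (m + n)\<close>.  For positive \<open>m\<close> this factor
  is never zero, so none of the vectors vanishes, and there are infinitely many independent ones.\<close>
lemma lowest_weight_nonpos: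
  fixes m :: int
  assumes fin: "finite S" "span S = UNIV"
    and e: "br t e = sc 2 e" and t: "t = br e f"
    and v: "br t v = sc (of_int m) v" "br f v = 0" "v \<noteq> 0"
  shows "m \<le> 0"
proof (rule ccontr)
  assume "\<not> m \<le> 0"
  then have m: "m > 0" by simp
  define w where "w n = (br e ^^ n) v" for n
  have w_Suc: "w (Suc n) = br e (w n)" for n by (simp add: w_def)
  have weight: "br t (w n) = sc (of_int (m + 2 * int n)) (w n)" for n
  proof (induction n)
    case (Suc n)
    have "br t (w (Suc n)) = sc 2 (w (Suc n)) + sc (of_int (m + 2 * int n)) (w (Suc n))"
      by (simp only: w_Suc br_derivation[of t e] e br_scale_left Suc br_scale_right)
    then show ?case
      by (simp add: algebra_simps flip: scale_left_distrib)
  qed (simp add: w_def v)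
  have lower: "br f (w (Suc n)) = sc (- (of_nat (Suc n) * of_int (m + int n))) (w n)" for n
  proof (induction n)
    case 0
    have "br f (w (Suc 0)) = - br t v + br e (br f v)"
      by (simp add: w_def br_derivation[of f e] t br_antisym[of f e] br_minus_left)
    then show ?case by (simp add: v br_zero_right w_def)
  next
    case (Suc n)
    have "br f (w (Suc (Suc n))) = - br t (w (Suc n)) + br e (br f (w (Suc n)))"
      by (simp add: w_Suc[of "Suc n"] br_derivation[of f e] t br_antisym[of f e] br_minus_left)
    also have "\<dots> = sc (- of_int (m + 2 * int (Suc n))) (w (Suc n)) +
        sc (- (of_nat (Suc n) * of_int (m + int n))) (w (Suc n))"
      by (simp only: weight Suc br_scale_right scale_minus_left br_minus_right flip: w_Suc)
    also have "\<dots> = sc (- (of_nat (Suc (Suc n)) * of_int (m + int (Suc n)))) (w (Suc n))"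
      by (simp add: algebra_simps flip: scale_left_distrib)
    finally show ?case .
  qed
  have nz: "w n \<noteq> 0" for n
  proof (induction n)
    case (Suc n)
    have "- (of_nat (Suc n) * of_int (m + int n)) \<noteq> (0 :: complex)"
      using m by (simp del: of_nat_Suc of_int_add)
    with Suc have "br f (w (Suc n)) \<noteq> 0"
      unfolding lower by (simp only: scale_eq_0_iff) simp
    then show ?case by (auto simp: br_zero_right)
  qed (simp add: w_def v)
  define I where "I = {..card S}"
  have indep: "inj_on w I \<and> independent (w ` I)"
    by (rule eigenvectors_independent[OF br_linear_right[of t]])
      (auto simp: I_def inj_on_def weight nz simp flip: of_int_add of_int_mult)
  then have "card (w ` I) \<le> card S"
    using independent_span_bound[OF fin(1)] fin(2) by auto
  then show False
    using indep by (simp add: card_image I_def)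
qed

text \<open>In the induction step a simultaneous eigenvector for \<open>S\<close> is decomposed into eigenvectors of \<open>br y\<close>.
  Since \<open>br s\<close> for \<open>s \<in> S\<close> commutes with \<open>br y\<close>, it preserves the eigenspaces of \<open>br y\<close>, and by independence
  of these each component is again an eigenvector of \<open>br s\<close>.\<close>
lemma simultaneous_eigenvectors_span:
  assumes "finite S" "\<And>x y. \<lbrakk>x \<in> S; y \<in> S\<rbrakk> \<Longrightarrow> br x y = 0" "\<And>x. x \<in> S \<Longrightarrow> ad_diagonalizable x"
  shows "span {v. \<forall>x\<in>S. \<exists>c. br x v = sc c v} = UNIV"
  using assms
proof (induction S)
  case (insert y S)
  let ?E = "\<lambda>S. {v. \<forall>x\<in>S. \<exists>c. br x v = sc c v}"
  have "v \<in> span (?E (insert y S))" if v: "v \<in> ?E S" for v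
  proof -
    obtain B where B: "span B = UNIV" "\<forall>b\<in>B. \<exists>c. br y b = sc c b"
      using insert.prems(2)[of y] by (auto simp: ad_diagonalizable_def)
    obtain c where c: "\<forall>b\<in>B. br y b = sc (c b) b"
      using B(2) by metis
    obtain F r where F: "finite F" "F \<subseteq> B" "v = (\<Sum>b\<in>F. sc (r b) b)"
    proof -
      have "v \<in> span B" by (simp add: B(1))
      then show thesis unfolding span_explicit using that by blast
    qed
    define C where "C = c ` F"
    define u where "u k = (\<Sum>b | b \<in> F \<and> c b = k. sc (r b) b)" for k
    have C: "finite C" using F by (simp add: C_def)
    have v_eq: "v = (\<Sum>k\<in>C. u k)"
      unfolding F(3) u_def C_def using F(1) by (rule sum.image_gen)
    have y_u: "br y (u k) = sc k (u k)" for k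
      using c F(2) unfolding u_def br_sum_right scale_sum_right
      by (intro sum.cong) (auto simp: br_scale_right mult.commute)
    have "br s (u k) = sc a (u k)" if s: "s \<in> S" and a: "br s v = sc a v" and k: "k \<in> C" for s a k
    proof -
      let ?d = "\<lambda>k. br s (u k) - sc a (u k)"
      have commute: "br y (br s z) = br s (br y z)" for z
        using br_derivation[of y s z] insert.prems(1)[of y s] s by (simp add: br_zero_left)
      have "(\<Sum>k\<in>C. ?d k) = 0"
        using a by (simp add: v_eq sum_subtractf br_sum_right scale_sum_right)
      moreover have "br y (?d k) = sc k (?d k)" for k
        by (simp add: br_diff_right commute y_u br_scale_right scale_right_diff_distrib mult.commute)
      ultimately have "\<forall>k\<in>C. ?d k = 0"
        by (intro eigenvector_sum_eq_zero[OF br_linear_right[of y] C, of "\<lambda>k. k"]) auto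
      with k show ?thesis by simp
    qed
    with v have "\<forall>k\<in>C. u k \<in> ?E (insert y S)"
      using y_u by fastforce
    then show ?thesis
      unfolding v_eq by (intro span_sum span_base) blast
  qed
  then have "span (?E S) \<subseteq> span (?E (insert y S))"
    by (intro span_minimal) auto
  with insert show ?case by auto
qed simp

end

section \<open>Signs and nondegeneracy of the Cartan matrix\<close>

locale simple_root_system = complex_lie_algebra sc br
  for sc :: "complex \<Rightarrow> 'g::ab_group_add \<Rightarrow> 'g" and br :: "'g \<Rightarrow> 'g \<Rightarrow> 'g" +
  fixes h :: "'g set"
    and l :: nat
    and \<alpha> :: "nat \<Rightarrow> 'g \<Rightarrow> complex"
    and a :: "nat \<Rightarrow> nat \<Rightarrow> int"
  assumes finite_dim: "\<exists>S. finite S \<and> span S = UNIV"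
    and cartan: "cartan_subalgebra h"
    and simple: "simple_roots h l \<alpha>"
    and matrix: "cartan_matrix h l \<alpha> a"
begin

lemma subspace_h: "subspace h"
  using cartan by (simp add: cartan_subalgebra_def)

lemma independent_simple:
  assumes "(\<Sum>i=1..l. fun_scale (x i) (\<alpha> i)) = 0" "i \<in> {1..l}"
  shows "x i = 0"
  using functional.independent_family_iff[of "{1..l}" \<alpha>] simple assms
  by (simp only: simple_roots_def) blast

lemma span_simple: "functional.span (\<alpha> ` {1..l}) = dual_space h"
  using simple by (simp add: simple_roots_def)

lemma simple_in_dual: "i \<in> {1..l} \<Longrightarrow> \<alpha> i \<in> dual_space h"
  by (metis span_simple functional.span_base imageI)

lemma dual_space_expansion:
  assumes "v \<in> dual_space h"
  shows "\<exists>x. v = (\<Sum>i=1..l. fun_scale (x i) (\<alpha> i))"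
proof -
  have inj: "inj_on \<alpha> {1..l}" using simple by (simp add: simple_roots_def)
  obtain y where "v = (\<Sum>w\<in>\<alpha> ` {1..l}. fun_scale (y w) w)"
    using assms by (auto simp: functional.span_finite simp flip: span_simple)
  then show ?thesis
    by (intro exI[of _ "\<lambda>k. y (\<alpha> k)"]) (simp only: sum.reindex[OF inj] comp_def)
qed

lemma dual_space_sum:
  assumes "f \<in> dual_space h" "\<And>i. i \<in> A \<Longrightarrow> t i \<in> h"
  shows "f (\<Sum>i\<in>A. sc (x i) (t i)) = (\<Sum>i\<in>A. x i * f (t i))"
proof -
  have add: "f (y + z) = f y + f z" if "y \<in> h" "z \<in> h" for y z
    using assms(1) that by (simp add: dual_space_def)
  have scale: "f (sc k y) = k * f y" if "y \<in> h" for y k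
    using assms(1) that by (simp add: dual_space_def)
  have zero: "f 0 = 0"
    using scale[of 0 0] subspace_h by (simp add: subspace_0)
  show ?thesis
    using assms(2)
  proof (induction A rule: infinite_finite_induct)
    case (insert i A)
    have "(\<Sum>i\<in>A. sc (x i) (t i)) \<in> h" "sc (x i) (t i) \<in> h"
      using insert.prems by (auto intro!: subspace_sum[OF subspace_h] subspace_scale[OF subspace_h])
    with insert show ?case by (simp add: add scale)
  qed (simp_all add: zero)
qed

text \<open>The coefficients of \<open>\<alpha> j - \<alpha> i\<close> have both signs, which is impossible for a root.\<close>
lemma simple_diff_not_root:
  assumes i: "i \<in> {1..l}" and j: "j \<in> {1..l}" and "i \<noteq> j"
  shows "root_space h (\<alpha> j - \<alpha> i) = {0}"
proof (rule ccontr)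
  assume "root_space h (\<alpha> j - \<alpha> i) \<noteq> {0}"
  moreover have "\<alpha> j - \<alpha> i \<in> dual_space h"
    unfolding span_simple[symmetric] using i j
    by (intro functional.span_diff functional.span_base imageI)
  moreover have "\<alpha> j - \<alpha> i \<noteq> 0"
    using simple i j \<open>i \<noteq> j\<close> unfolding simple_roots_def right_minus_eq by (metis inj_onD)
  ultimately have "\<alpha> j - \<alpha> i \<in> roots h"
    by (simp add: roots_def)
  then obtain n :: "nat \<Rightarrow> nat" where n: "\<alpha> j - \<alpha> i = (\<Sum>k=1..l. fun_scale (of_nat (n k)) (\<alpha> k)) \<or>
      \<alpha> j - \<alpha> i = - (\<Sum>k=1..l. fun_scale (of_nat (n k)) (\<alpha> k))"
    using simple unfolding simple_roots_def by blast
  have single: "(\<Sum>k=1..l. fun_scale (if k = m then 1 else 0) (\<alpha> k)) = \<alpha> m" if "m \<in> {1..l}" for m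
    using that by (simp add: if_distrib[of "\<lambda>c. fun_scale c _"] cong: if_cong)
  define s :: "nat \<Rightarrow> complex" where "s k = (if k = j then 1 else 0) - (if k = i then 1 else 0)" for k
  have diff: "\<alpha> j - \<alpha> i = (\<Sum>k=1..l. fun_scale (s k) (\<alpha> k))"
    by (simp only: s_def functional.scale_left_diff_distrib sum_subtractf single i j)
  from n show False
  proof
    assume "\<alpha> j - \<alpha> i = (\<Sum>k=1..l. fun_scale (of_nat (n k)) (\<alpha> k))"
    then have "(\<Sum>k=1..l. fun_scale (s k - of_nat (n k)) (\<alpha> k)) = 0"
      by (simp only: diff functional.scale_left_diff_distrib sum_subtractf) simp
    then have "s i - of_nat (n i) = 0"
      by (rule independent_simple[OF _ i])
    then have "Re (s i - of_nat (n i)) = 0" by simp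
    then show False
      using \<open>i \<noteq> j\<close> by (simp add: s_def)
  next
    assume "\<alpha> j - \<alpha> i = - (\<Sum>k=1..l. fun_scale (of_nat (n k)) (\<alpha> k))"
    then have "(\<Sum>k=1..l. fun_scale (s k + of_nat (n k)) (\<alpha> k)) = 0"
      by (simp only: diff functional.scale_left_distrib sum.distrib) simp
    then have "s j + of_nat (n j) = 0"
      by (rule independent_simple[OF _ j])
    then have "Re (s j + of_nat (n j)) = 0" by simp
    then show False
      using \<open>i \<noteq> j\<close> by (simp add: s_def)
  qed
qed

definition coroot :: "nat \<Rightarrow> 'g"
  where "coroot i = (SOME t. is_coroot h (\<alpha> i) t \<and> (\<forall>j\<in>{1..l}. of_int (a i j) = \<alpha> j t))"

lemma coroot:
  assumes "i \<in> {1..l}"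
  shows "is_coroot h (\<alpha> i) (coroot i)" and "j \<in> {1..l} \<Longrightarrow> \<alpha> j (coroot i) = of_int (a i j)"
proof -
  have "\<exists>t. is_coroot h (\<alpha> i) t \<and> (\<forall>j\<in>{1..l}. of_int (a i j) = \<alpha> j t)"
    using matrix assms by (simp add: cartan_matrix_def)
  from someI_ex[OF this] show "is_coroot h (\<alpha> i) (coroot i)"
    and "j \<in> {1..l} \<Longrightarrow> \<alpha> j (coroot i) = of_int (a i j)"
    by (auto simp: coroot_def)
qed

lemma coroot_in: "i \<in> {1..l} \<Longrightarrow> coroot i \<in> h"
  using coroot(1) by (simp add: is_coroot_def)

lemma cartan_diagonal: "i \<in> {1..l} \<Longrightarrow> a i i = 2"
  using coroot[of i] unfolding is_coroot_def by (metis of_int_eq_numeral_iff)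

text \<open>A nonzero vector \<open>v\<close> of the root space of \<open>\<alpha> j\<close> has weight \<open>a i j\<close> under the coroot of \<open>\<alpha> i\<close>, and it is
  a lowest weight vector because \<open>br f v\<close> would have weight \<open>\<alpha> j - \<alpha> i\<close>.\<close>
lemma cartan_off_diagonal:
  assumes i: "i \<in> {1..l}" and j: "j \<in> {1..l}" and "i \<noteq> j"
  shows "a i j \<le> 0"
proof -
  obtain e f where e: "e \<in> root_space h (\<alpha> i)" and f: "f \<in> root_space h (- \<alpha> i)"
    and t: "coroot i = br e f"
    using coroot(1)[OF i] by (auto simp: is_coroot_def)
  have "\<alpha> j \<in> roots h"
    using simple j unfolding simple_roots_def by blast
  then have "root_space h (\<alpha> j) \<noteq> {0}"
    by (simp add: roots_def)
  moreover have "0 \<in> root_space h (\<alpha> j)"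
    by (simp add: root_space_def br_zero_right)
  ultimately obtain v where v: "v \<in> root_space h (\<alpha> j)" "v \<noteq> 0"
    by blast
  have "br f v \<in> root_space h (\<alpha> j - \<alpha> i)"
    using root_space_br[OF f v(1)] by (simp only: add.commute[of "- \<alpha> i"] diff_conv_add_uminus)
  then have "br f v = 0"
    using simple_diff_not_root[OF assms] by simp
  moreover have "br (coroot i) e = sc 2 e"
    using e coroot(1)[OF i] by (simp add: root_space_def is_coroot_def)
  moreover have "br (coroot i) v = sc (of_int (a i j)) v"
    using v(1) coroot_in[OF i] coroot(2)[OF i j] by (simp add: root_space_def)
  ultimately show ?thesis
    using lowest_weight_nonpos finite_dim t v(2) by blast
qed

text \<open>It suffices to diagonalize a finite basis of \<open>h\<close>.\<close>
lemma ex_weight_basis: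
  "\<exists>Bs. finite Bs \<and> independent Bs \<and> span Bs = UNIV \<and> (\<forall>b\<in>Bs. \<forall>y\<in>h. \<exists>c. br y b = sc c b)"
proof -
  obtain S where S: "finite S" "span S = UNIV" using finite_dim by blast
  obtain H where H: "H \<subseteq> h" "independent H" "h \<subseteq> span H"
    by (rule maximal_independent_subset)
  have "finite H" using independent_span_bound[OF S(1) H(2)] S(2) by simp
  define E where "E = {v. \<forall>x\<in>H. \<exists>c. br x v = sc c v}"
  have E: "span E = UNIV"
    unfolding E_def
  proof (rule simultaneous_eigenvectors_span[OF \<open>finite H\<close>])
    show "br x y = 0" if "x \<in> H" "y \<in> H" for x y
      using cartan H(1) that unfolding cartan_subalgebra_def by blast
    show "ad_diagonalizable x" if "x \<in> H" for x
      using cartan H(1) that unfolding cartan_subalgebra_def by blast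
  qed
  obtain Bs where Bs: "Bs \<subseteq> E" "independent Bs" "E \<subseteq> span Bs"
    by (rule maximal_independent_subset)
  have fin: "finite Bs" using independent_span_bound[OF S(1) Bs(2)] S(2) by simp
  have "span E \<subseteq> span Bs"
    using Bs(3) by (intro span_minimal) auto
  then have span: "span Bs = UNIV" using E by auto
  have eigen: "\<exists>c. br y b = sc c b" if "b \<in> Bs" "y \<in> h" for b y
  proof -
    have "y \<in> span H" using H(3) that(2) by blast
    then show ?thesis
    proof (induction rule: span_induct)
      case base
      show ?case
      proof (rule subspaceI)
        show "0 \<in> {y. \<exists>c. br y b = sc c b}"
          by (auto simp: br_zero_left intro!: exI[of _ 0])
      qed (auto simp: br_add_left br_scale_left simp flip: scale_left_distrib)
    next
      case (step x)
      then show ?case using Bs(1) \<open>b \<in> Bs\<close> by (auto simp: E_def)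
    qed
  qed
  show ?thesis using fin Bs(2) span eigen by blast
qed

definition weight_basis :: "'g set"
  where "weight_basis = (SOME Bs. finite Bs \<and> independent Bs \<and> span Bs = UNIV \<and>
    (\<forall>b\<in>Bs. \<forall>y\<in>h. \<exists>c. br y b = sc c b))"

text \<open>Extended by zero outside \<open>h\<close>, as for all elements of \<open>dual_space h\<close>, so that a nonzero weight is
  literally one of the \<open>roots h\<close>.\<close>
definition weight :: "'g \<Rightarrow> 'g \<Rightarrow> complex"
  where "weight b y = (if y \<in> h then SOME c. br y b = sc c b else 0)"

lemma weight_basis:
  "finite weight_basis" "independent weight_basis" "span weight_basis = UNIV"
  "\<lbrakk>b \<in> weight_basis; y \<in> h\<rbrakk> \<Longrightarrow> br y b = sc (weight b y) b"
proof -
  note * = someI_ex[OF ex_weight_basis, folded weight_basis_def]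
  show "finite weight_basis" "independent weight_basis" "span weight_basis = UNIV"
    using * by blast+
  assume "b \<in> weight_basis" "y \<in> h"
  with * have "\<exists>c. br y b = sc c b" by blast
  from someI_ex[OF this] show "br y b = sc (weight b y) b"
    using \<open>y \<in> h\<close> by (simp add: weight_def)
qed

lemma weight_basis_nonzero: "b \<in> weight_basis \<Longrightarrow> b \<noteq> 0"
  using weight_basis(2) dependent_zero by blast

lemma weight_in_dual:
  assumes b: "b \<in> weight_basis"
  shows "weight b \<in> dual_space h"
proof -
  have "weight b (x + y) = weight b x + weight b y" if "x \<in> h" "y \<in> h" for x y
  proof -
    have "sc (weight b (x + y)) b = sc (weight b x + weight b y) b"
      using that subspace_add[OF subspace_h] b
      by (simp add: br_add_left scale_left_distrib flip: weight_basis(4))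
    then show ?thesis using weight_basis_nonzero[OF b] by simp
  qed
  moreover have "weight b (sc k x) = k * weight b x" if "x \<in> h" for k x
  proof -
    have "sc (weight b (sc k x)) b = sc (k * weight b x) b"
      using that subspace_scale[OF subspace_h] b
      by (simp add: br_scale_left flip: weight_basis(4) scale_scale)
    then show ?thesis using weight_basis_nonzero[OF b] by simp
  qed
  ultimately show ?thesis
    by (simp add: dual_space_def weight_def)
qed

text \<open>The values of roots on the coroots are integers, as roots are integral combinations of simple roots
  and the Cartan matrix is integral.\<close>
lemma weight_coroot_real:
  assumes b: "b \<in> weight_basis" and i: "i \<in> {1..l}"
  shows "weight b (coroot i) \<in> \<real>"
proof (cases "weight b = 0")
  case False
  have "b \<in> root_space h (weight b)"
    using weight_basis(4)[OF b] by (simp add: root_space_def)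
  then have "weight b \<in> roots h"
    using False weight_in_dual[OF b] weight_basis_nonzero[OF b] by (auto simp: roots_def)
  then obtain n :: "nat \<Rightarrow> nat" where n: "weight b = (\<Sum>k=1..l. fun_scale (of_nat (n k)) (\<alpha> k)) \<or>
      weight b = - (\<Sum>k=1..l. fun_scale (of_nat (n k)) (\<alpha> k))"
    using simple unfolding simple_roots_def by blast
  have "(\<Sum>k=1..l. fun_scale (of_nat (n k)) (\<alpha> k)) (coroot i) = (\<Sum>k=1..l. of_nat (n k) * of_int (a i k))"
    using i by (simp add: sum_fun_apply fun_scale_def coroot(2))
  also have "\<dots> \<in> \<real>"
    by (intro sum_in_Reals Reals_mult) auto
  finally show ?thesis
    using n by auto
qed simp

definition coord :: "'g \<Rightarrow> 'g \<Rightarrow> complex"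
  where "coord b v = representation weight_basis v b"

lemma coord_diff: "coord b (v - w) = coord b v - coord b w"
  and coord_scale: "coord b (sc k v) = k * coord b v"
  and coord_sum: "coord b (\<Sum>i\<in>A. f i) = (\<Sum>i\<in>A. coord b (f i))"
  by (simp_all add: coord_def weight_basis representation_diff representation_scale
      representation_sum)

lemma coord_expansion: "(\<Sum>b\<in>weight_basis. sc (coord b v) b) = v"
  unfolding coord_def by (rule sum_representation_eq) (auto simp: weight_basis)

lemma coord_self: "b \<in> weight_basis \<Longrightarrow> coord b b = 1"
  by (simp add: coord_def representation_basis weight_basis)

text \<open>Taking the diagonal entries in the weight basis makes the Killing form of elements of \<open>h\<close> the sum of
  the products of their eigenvalues.\<close>
definition trace :: "('g \<Rightarrow> 'g) \<Rightarrow> complex"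
  where "trace T = (\<Sum>b\<in>weight_basis. coord b (T b))"

lemma trace_commute:
  assumes "Vector_Spaces.linear sc sc S" "Vector_Spaces.linear sc sc T"
  shows "trace (\<lambda>x. S (T x)) = trace (\<lambda>x. T (S x))"
proof -
  have comp: "trace (\<lambda>x. S (T x)) =
      (\<Sum>b\<in>weight_basis. \<Sum>b'\<in>weight_basis. coord b' (T b) * coord b (S b'))"
    if "Vector_Spaces.linear sc sc S" for S T
  proof -
    interpret S: Vector_Spaces.linear sc sc S by (rule that)
    have "S (T b) = (\<Sum>b'\<in>weight_basis. sc (coord b' (T b)) (S b'))" for b
      by (subst coord_expansion[of "T b", symmetric]) (simp only: S.sum S.scale)
    then show ?thesis
      by (simp add: trace_def coord_sum coord_scale)
  qed
  show ?thesis
    unfolding comp[OF assms(1)] comp[OF assms(2)]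
    by (subst sum.swap) (simp add: mult.commute)
qed

definition killing :: "'g \<Rightarrow> 'g \<Rightarrow> complex"
  where "killing x y = trace (\<lambda>z. br x (br y z))"

lemma killing_scale_right: "killing x (sc k y) = k * killing x y"
  by (simp add: killing_def trace_def br_scale_left br_scale_right coord_scale sum_distrib_left)

text \<open>Both sides differ from the trace of \<open>br x \<circ> br y \<circ> br z\<close> by traces of cyclically permuted products.\<close>
lemma killing_invariant: "killing (br x y) z = killing x (br y z)"
proof -
  have xy: "br (br x y) (br z b) = br x (br y (br z b)) - br y (br x (br z b))" for b
    using br_derivation[of x y "br z b"] by simp
  have yz: "br x (br (br y z) b) = br x (br y (br z b)) - br x (br z (br y b))" for b
    using br_derivation[of y z b] by (simp add: br_add_right)
  have "Vector_Spaces.linear sc sc (\<lambda>v. br x (br z v))"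
    by (simp add: Vector_Spaces.linear_iff vector_space_axioms br_add_right br_scale_right)
  from trace_commute[OF br_linear_right[of y] this]
  show ?thesis
    by (simp add: killing_def xy yz trace_def coord_diff sum_subtractf)
qed

lemma killing_cartan:
  assumes "x \<in> h" "y \<in> h"
  shows "killing x y = (\<Sum>b\<in>weight_basis. weight b x * weight b y)"
  using assms
  by (simp add: killing_def trace_def weight_basis(4) br_scale_right coord_scale coord_self mult.commute)

text \<open>If the coroot is \<open>br e f\<close>, invariance gives \<open>killing (br e f) y = killing e (br f y)\<close>, and \<open>f\<close> is an
  eigenvector of \<open>y\<close>; so \<open>\<kappa> = killing e f\<close>.  If this were zero, then so would be the sum of the squares of
  the real eigenvalues of \<open>br (coroot i)\<close>, and \<open>coroot i\<close> would act by zero;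
  as it acts on \<open>e\<close> by \<open>2\<close>, then \<open>e\<close> and with it \<open>coroot i\<close> would be zero.\<close>
lemma killing_coroot:
  assumes i: "i \<in> {1..l}"
  shows "\<exists>\<kappa>. \<kappa> \<noteq> 0 \<and> (\<forall>y\<in>h. killing (coroot i) y = \<kappa> * \<alpha> i y)"
proof -
  obtain e f where e: "e \<in> root_space h (\<alpha> i)" and f: "f \<in> root_space h (- \<alpha> i)"
    and t: "coroot i = br e f" and two: "\<alpha> i (coroot i) = 2"
    using coroot(1)[OF i] by (auto simp: is_coroot_def)
  have eq: "killing (coroot i) y = killing e f * \<alpha> i y" if "y \<in> h" for y
  proof -
    have "br f y = sc (\<alpha> i y) f"
      using f that br_antisym[of f y] by (simp add: root_space_def)
    then show ?thesis
      by (simp add: t killing_invariant killing_scale_right)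
  qed
  have "killing e f \<noteq> 0"
  proof
    assume "killing e f = 0"
    then have "killing (coroot i) (coroot i) = 0"
      using eq[OF coroot_in[OF i]] by simp
    then have "(\<Sum>b\<in>weight_basis. weight b (coroot i) * weight b (coroot i)) = 0"
      by (simp add: killing_cartan coroot_in[OF i])
    moreover have "weight b (coroot i) * weight b (coroot i) = of_real (Re (weight b (coroot i)) ^ 2)"
      if "b \<in> weight_basis" for b
      using weight_coroot_real[OF that i] by (metis of_real_Re of_real_mult power2_eq_square)
    ultimately have "of_real (\<Sum>b\<in>weight_basis. Re (weight b (coroot i)) ^ 2) = (0 :: complex)"
      by (simp only: of_real_sum cong: sum.cong)
    then have "(\<Sum>b\<in>weight_basis. Re (weight b (coroot i)) ^ 2) = 0"
      by (simp only: of_real_eq_0_iff)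
    then have "Re (weight b (coroot i)) = 0" if "b \<in> weight_basis" for b
      using that weight_basis(1) by (simp add: sum_nonneg_eq_0_iff)
    then have "weight b (coroot i) = 0" if "b \<in> weight_basis" for b
      using weight_coroot_real[OF that i] that by (simp add: complex_is_Real_iff complex_eq_iff)
    then have "br (coroot i) b = 0" if "b \<in> weight_basis" for b
      using that weight_basis(4)[OF that coroot_in[OF i]] by simp
    then have "br (coroot i) (\<Sum>b\<in>weight_basis. sc (coord b e) b) = 0"
      by (simp add: br_sum_right br_scale_right)
    then have "sc 2 e = 0"
      using e coroot_in[OF i] two by (simp add: coord_expansion root_space_def)
    then have "coroot i = 0"
      by (simp add: t br_zero_left)
    moreover have "\<alpha> i (sc 0 (coroot i)) = 0 * \<alpha> i (coroot i)"
      using simple_in_dual[OF i] coroot_in[OF i] unfolding dual_space_def by blast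
    ultimately show False using two by simp
  qed
  with eq show ?thesis by blast
qed

text \<open>Write \<open>v = \<Sum>i x i \<alpha> i\<close>.  By the previous lemma \<open>v\<close> is the functional \<open>killing w\<close> for
  \<open>w = \<Sum>i (x i / \<kappa> i) coroot i\<close>.  Let \<open>w'\<close> be the combination of coroots with conjugate coefficients.
  As the weights are real on coroots, \<open>v w' = killing w w'\<close> is the sum of the squared norms of the eigenvalues
  of \<open>w\<close>.  But \<open>v w' = 0\<close>, as \<open>v\<close> vanishes on coroots; hence \<open>w\<close> has only the eigenvalue zero and
  \<open>v = killing w\<close> is zero on \<open>h\<close>.\<close>
lemma coroots_separate:
  assumes v: "v \<in> dual_space h" and zero: "\<forall>i\<in>{1..l}. v (coroot i) = 0"
  shows "v = 0"
proof -
  obtain x where x: "v = (\<Sum>i=1..l. fun_scale (x i) (\<alpha> i))"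
    using dual_space_expansion[OF v] by blast
  obtain \<kappa> where \<kappa>: "\<forall>i\<in>{1..l}. \<kappa> i \<noteq> 0 \<and> (\<forall>y\<in>h. killing (coroot i) y = \<kappa> i * \<alpha> i y)"
    using killing_coroot by metis
  define w where "w = (\<Sum>i=1..l. sc (x i / \<kappa> i) (coroot i))"
  define w' where "w' = (\<Sum>i=1..l. sc (cnj (x i / \<kappa> i)) (coroot i))"
  have w_in: "w \<in> h" "w' \<in> h"
    unfolding w_def w'_def
    by (auto intro!: subspace_sum[OF subspace_h] subspace_scale[OF subspace_h] coroot_in)
  have weight_w: "weight b w = (\<Sum>i=1..l. x i / \<kappa> i * weight b (coroot i))"
    "weight b w' = (\<Sum>i=1..l. cnj (x i / \<kappa> i) * weight b (coroot i))" if "b \<in> weight_basis" for b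
    unfolding w_def w'_def by (intro dual_space_sum[OF weight_in_dual[OF that]] coroot_in; assumption)+
  have kill: "killing w y = v y" if "y \<in> h" for y
  proof -
    have "killing w y = (\<Sum>b\<in>weight_basis. \<Sum>i=1..l. x i / \<kappa> i * (weight b (coroot i) * weight b y))"
      using that by (simp add: killing_cartan w_in weight_w sum_distrib_right mult.assoc)
    also have "\<dots> = (\<Sum>i=1..l. x i / \<kappa> i * killing (coroot i) y)"
      using that by (subst sum.swap) (simp add: killing_cartan coroot_in sum_distrib_left)
    also have "\<dots> = (\<Sum>i=1..l. x i * \<alpha> i y)"
      using that \<kappa> by (intro sum.cong) auto
    finally show ?thesis
      by (simp add: x sum_fun_apply fun_scale_def)
  qed
  have "weight b w' = cnj (weight b w)" if "b \<in> weight_basis" for b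
    using weight_coroot_real[OF that] by (simp add: weight_w[OF that] Reals_cnj_iff)
  then have "killing w w' = (\<Sum>b\<in>weight_basis. of_real (norm (weight b w) ^ 2))"
    by (simp add: killing_cartan w_in complex_norm_square del: of_real_power)
  moreover have "v w' = (\<Sum>i=1..l. cnj (x i / \<kappa> i) * v (coroot i))"
    unfolding w'_def by (intro dual_space_sum[OF v] coroot_in)
  then have "v w' = 0"
    using zero by simp
  ultimately have "(\<Sum>b\<in>weight_basis. norm (weight b w) ^ 2) = 0"
    using kill[OF w_in(2)] by (metis of_real_eq_0_iff of_real_sum)
  then have "\<forall>b\<in>weight_basis. weight b w = 0"
    using weight_basis(1) by (simp add: sum_nonneg_eq_0_iff)
  then have "v y = 0" if "y \<in> h" for y
    using kill[OF that] that by (simp add: killing_cartan w_in)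
  moreover have "v y = 0" if "y \<notin> h" for y
    using v that by (simp add: dual_space_def)
  ultimately show ?thesis by (auto simp: fun_eq_iff)
qed

end

section \<open>The augmentation as a character of a presented algebra\<close>

text \<open>The evaluation homomorphism of the free algebra at \<open>1\<close> for every generator: each word has the value \<open>1\<close>.\<close>
definition augmentation :: "free_alg \<Rightarrow> complex"
  where "augmentation p = (\<Sum>w\<in>Poly_Mapping.keys p. Poly_Mapping.lookup p w)"

lemma augmentation_eq_sum:
  assumes "finite A" "Poly_Mapping.keys p \<subseteq> A"
  shows "augmentation p = (\<Sum>w\<in>A. Poly_Mapping.lookup p w)"
  unfolding augmentation_def using assms
  by (intro sum.mono_neutral_left) (auto simp: in_keys_iff)

lemma augmentation_add: "augmentation (p + q) = augmentation p + augmentation q"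
proof -
  let ?A = "Poly_Mapping.keys p \<union> Poly_Mapping.keys q"
  have "Poly_Mapping.keys (p + q) \<subseteq> ?A" by (rule Poly_Mapping.keys_add)
  then show ?thesis
    by (simp add: augmentation_eq_sum[of ?A] lookup_add sum.distrib)
qed

lemma augmentation_single: "augmentation (Poly_Mapping.single w x) = x"
  by (simp add: augmentation_def)

lemma augmentation_zero: "augmentation 0 = 0"
  by (simp add: augmentation_def)

lemma augmentation_sum: "augmentation (\<Sum>x\<in>A. f x) = (\<Sum>x\<in>A. augmentation (f x))"
  by (induction A rule: infinite_finite_induct) (auto simp: augmentation_zero augmentation_add)

lemma free_alg_expansion:
  fixes p :: free_alg
  shows "p = (\<Sum>w\<in>Poly_Mapping.keys p. Poly_Mapping.single w (Poly_Mapping.lookup p w))"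
  by (rule poly_mapping_eqI) (auto simp: lookup_sum lookup_single when_def in_keys_iff)

lemma augmentation_mult: "augmentation (p * q) = augmentation p * augmentation q"
proof -
  have "p * q = (\<Sum>v\<in>Poly_Mapping.keys p. \<Sum>w\<in>Poly_Mapping.keys q.
      Poly_Mapping.single (v + w) (Poly_Mapping.lookup p v * Poly_Mapping.lookup q w))"
    by (subst free_alg_expansion[of p], subst free_alg_expansion[of q])
      (simp add: sum_product mult_single)
  then have "augmentation (p * q) = (\<Sum>v\<in>Poly_Mapping.keys p. \<Sum>w\<in>Poly_Mapping.keys q.
      Poly_Mapping.lookup p v * Poly_Mapping.lookup q w)"
    by (simp add: augmentation_sum augmentation_single)
  also have "\<dots> = augmentation p * augmentation q"
    by (simp add: augmentation_def sum_product)
  finally show ?thesis .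
qed

lemma augmentation_one: "augmentation 1 = 1"
  by (simp add: augmentation_def)

lemma augmentation_power: "augmentation (p ^ n) = augmentation p ^ n"
  by (induction n) (auto simp: augmentation_one augmentation_mult)

lemma augmentation_generator: "augmentation (generator i) = 1"
  by (simp add: generator_def augmentation_single)

lemma augmentation_scalar: "augmentation (scalar x) = x"
  by (simp add: scalar_def augmentation_single)

lemma free_algebra_mult_closed:
  assumes "p \<in> carrier (free_algebra l)" "q \<in> carrier (free_algebra l)"
  shows "p * q \<in> carrier (free_algebra l)"
  using keys_mult[of p q] assms by (fastforce simp: free_algebra_def plus_list_def)

lemma free_algebra_add_closed:
  assumes "p \<in> carrier (free_algebra l)" "q \<in> carrier (free_algebra l)"
  shows "p + q \<in> carrier (free_algebra l)"
  using Poly_Mapping.keys_add[of p q] assms by (fastforce simp: free_algebra_def)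

lemma free_algebra_one_closed: "1 \<in> carrier (free_algebra l)"
  by (simp add: free_algebra_def zero_list_def)

lemma free_algebra_power_closed:
  "p \<in> carrier (free_algebra l) \<Longrightarrow> p ^ n \<in> carrier (free_algebra l)"
  by (induction n) (auto intro: free_algebra_one_closed free_algebra_mult_closed)

lemma free_algebra_sum_closed:
  "(\<And>x. x \<in> A \<Longrightarrow> f x \<in> carrier (free_algebra l)) \<Longrightarrow> (\<Sum>x\<in>A. f x) \<in> carrier (free_algebra l)"
proof (induction A rule: infinite_finite_induct)
  case (insert x A)
  then show ?case by (simp add: free_algebra_add_closed)
qed (simp_all add: free_algebra_def)

lemma ring_free_algebra: "ring (free_algebra l)"
proof (rule ringI)
  show "abelian_group (free_algebra l)"
  proof (rule abelian_groupI)
    fix p assume "p \<in> carrier (free_algebra l)"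
    then have "- p \<in> carrier (free_algebra l)"
      by (auto simp: free_algebra_def in_keys_iff subset_iff)
    then show "\<exists>q\<in>carrier (free_algebra l). q \<oplus>\<^bsub>free_algebra l\<^esub> p = \<zero>\<^bsub>free_algebra l\<^esub>"
      by (intro bexI[of _ "- p"]) (auto simp: free_algebra_def)
  next
    fix p q assume "p \<in> carrier (free_algebra l)" "q \<in> carrier (free_algebra l)"
    then show "p \<oplus>\<^bsub>free_algebra l\<^esub> q \<in> carrier (free_algebra l)"
      using free_algebra_add_closed by (simp add: free_algebra_def)
  qed (auto simp: free_algebra_def algebra_simps)
  show "Group.monoid (free_algebra l)"
  proof (rule monoidI)
    fix p q assume "p \<in> carrier (free_algebra l)" "q \<in> carrier (free_algebra l)"
    then show "p \<otimes>\<^bsub>free_algebra l\<^esub> q \<in> carrier (free_algebra l)"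
      using free_algebra_mult_closed by (simp add: free_algebra_def)
  next
    show "\<one>\<^bsub>free_algebra l\<^esub> \<in> carrier (free_algebra l)"
      using free_algebra_one_closed by (simp add: free_algebra_def)
  qed (auto simp: free_algebra_def algebra_simps)
qed (auto simp: free_algebra_def algebra_simps)

lemma ring_complex_field: "ring complex_field"
proof (rule ringI)
  show "abelian_group complex_field"
  proof (rule abelian_groupI)
    fix x assume "x \<in> carrier complex_field"
    show "\<exists>y\<in>carrier complex_field. y \<oplus>\<^bsub>complex_field\<^esub> x = \<zero>\<^bsub>complex_field\<^esub>"
      by (intro bexI[of _ "- x"]) (auto simp: complex_field_def)
  qed (auto simp: complex_field_def)
  show "Group.monoid complex_field"
    by (rule monoidI) (auto simp: complex_field_def)
qed (auto simp: complex_field_def algebra_simps)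

lemma augmentation_ring_hom: "ring_hom_ring (free_algebra l) complex_field augmentation"
  by (intro ring_hom_ringI2 ring_free_algebra ring_complex_field ring_hom_memI)
    (auto simp: free_algebra_def complex_field_def augmentation_mult augmentation_add augmentation_one)

lemma generator_closed: "i \<in> {1..l} \<Longrightarrow> generator i \<in> carrier (free_algebra l)"
  by (simp add: free_algebra_def generator_def)

lemma scalar_closed: "scalar x \<in> carrier (free_algebra l)"
  by (simp add: free_algebra_def scalar_def)

lemma ideal_relation_ideal:
  "S \<subseteq> carrier (free_algebra l) \<Longrightarrow> ideal (relation_ideal l S) (free_algebra l)"
  unfolding relation_ideal_def by (rule ring.genideal_ideal[OF ring_free_algebra])

lemma carrier_presented_algebra:
  "carrier (presented_algebra l S) = quotient_class l S ` carrier (free_algebra l)"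
  by (auto simp: presented_algebra_def Let_def FactRing_def A_RCOSETS_def' quotient_class_def)

lemma quotient_class_mult:
  assumes "S \<subseteq> carrier (free_algebra l)"
    "p \<in> carrier (free_algebra l)" "q \<in> carrier (free_algebra l)"
  shows "quotient_class l S p \<otimes>\<^bsub>presented_algebra l S\<^esub> quotient_class l S q = quotient_class l S (p * q)"
  using ideal.rcoset_mult_add[OF ideal_relation_ideal, OF assms]
  by (simp add: presented_algebra_def Let_def FactRing_def quotient_class_def)
    (simp add: free_algebra_def)

lemma quotient_class_add:
  assumes "S \<subseteq> carrier (free_algebra l)"
    "p \<in> carrier (free_algebra l)" "q \<in> carrier (free_algebra l)"
  shows "quotient_class l S p \<oplus>\<^bsub>presented_algebra l S\<^esub> quotient_class l S q = quotient_class l S (p + q)"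
  using ring_hom_add[OF ideal.rcos_ring_hom[OF ideal_relation_ideal], OF assms]
  by (simp add: presented_algebra_def Let_def FactRing_def quotient_class_def)
    (simp add: free_algebra_def)

lemma quotient_class_one:
  "\<one>\<^bsub>presented_algebra l S\<^esub> = quotient_class l S 1"
  by (simp add: presented_algebra_def Let_def FactRing_def quotient_class_def)
    (simp add: free_algebra_def)

lemma quotient_class_smult:
  assumes "S \<subseteq> carrier (free_algebra l)" "p \<in> carrier (free_algebra l)"
  shows "x \<odot>\<^bsub>presented_algebra l S\<^esub> quotient_class l S p = quotient_class l S (scalar x * p)"
proof -
  have "x \<odot>\<^bsub>presented_algebra l S\<^esub> quotient_class l S p =
      quotient_class l S (scalar x) \<otimes>\<^bsub>presented_algebra l S\<^esub> quotient_class l S p"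
    by (simp add: presented_algebra_def Let_def)
  then show ?thesis
    by (simp add: quotient_class_mult[OF assms(1) scalar_closed assms(2)])
qed

text \<open>The kernel of the augmentation is an ideal that contains \<open>S\<close>, hence contains the ideal generated by \<open>S\<close>;
  so the augmentation is constant on cosets.\<close>
lemma augmentation_quotient_class:
  assumes S: "S \<subseteq> carrier (free_algebra l)" and zero: "\<And>s. s \<in> S \<Longrightarrow> augmentation s = 0"
  shows "augmentation ` quotient_class l S p = {augmentation p}"
proof -
  let ?K = "a_kernel (free_algebra l) complex_field augmentation"
  have K: "?K = {p \<in> carrier (free_algebra l). augmentation p = 0}"
    unfolding a_kernel_def' by (simp add: complex_field_def)
  have "relation_ideal l S \<subseteq> ?K"
    unfolding relation_ideal_def
    using S zero
    by (intro ring.genideal_minimal[OF ring_free_algebra]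
        ring_hom_ring.kernel_is_ideal[OF augmentation_ring_hom]) (auto simp: K)
  then have "augmentation z = 0" if "z \<in> relation_ideal l S" for z
    using that by (auto simp: K)
  moreover have "0 \<in> relation_ideal l S"
    using additive_subgroup.zero_closed[OF ideal.axioms(1)[OF ideal_relation_ideal[OF S]]]
    by (simp add: free_algebra_def)
  moreover have "quotient_class l S p = (\<lambda>z. z + p) ` relation_ideal l S"
    by (auto simp: quotient_class_def a_r_coset_def' free_algebra_def)
  ultimately show ?thesis
    by (force simp: image_image augmentation_add)
qed

text \<open>Words are products of generators, hence have the value \<open>1\<close>, and every element is a linear combination of
  words.\<close>
lemma character_is_augmentation:
  assumes S: "S \<subseteq> carrier (free_algebra l)"
    and char: "is_character (presented_algebra l S) chi"
    and gen: "\<forall>i\<in>{1..l}. chi (quotient_class l S (generator i)) = 1"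
    and p: "p \<in> carrier (free_algebra l)"
  shows "chi (quotient_class l S p) = augmentation p"
proof -
  let ?A = "presented_algebra l S" and ?cl = "quotient_class l S" and ?F = "carrier (free_algebra l)"
  have hom: "chi \<in> ring_hom ?A complex_field"
    using char by (simp add: is_character_def)
  have carr: "?cl x \<in> carrier ?A" if "x \<in> ?F" for x
    using that by (auto simp: carrier_presented_algebra)
  have mult: "chi (?cl (x * y)) = chi (?cl x) * chi (?cl y)" if "x \<in> ?F" "y \<in> ?F" for x y
    using ring_hom_mult[OF hom carr[OF that(1)] carr[OF that(2)]] that
    by (simp add: quotient_class_mult[OF S]) (simp add: complex_field_def)
  have add: "chi (?cl (x + y)) = chi (?cl x) + chi (?cl y)" if "x \<in> ?F" "y \<in> ?F" for x y
    using ring_hom_add[OF hom carr[OF that(1)] carr[OF that(2)]] that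
    by (simp add: quotient_class_add[OF S]) (simp add: complex_field_def)
  have scal: "chi (?cl (scalar x)) = x" for x
  proof -
    have "chi (?cl (scalar x)) = chi (x \<odot>\<^bsub>?A\<^esub> ?cl 1)"
      by (simp add: quotient_class_smult[OF S free_algebra_one_closed])
    also have "\<dots> = x * chi (?cl 1)"
      using char carr[OF free_algebra_one_closed] by (simp add: is_character_def)
    also have "chi (?cl 1) = 1"
      using ring_hom_one[OF hom] by (simp add: quotient_class_one) (simp add: complex_field_def)
    finally show ?thesis by simp
  qed
  have single: "Poly_Mapping.single w x \<in> ?F \<and> chi (?cl (Poly_Mapping.single w x)) = x"
    if "w \<in> lists {1..l}" for w x
    using that
  proof (induction w)
    case Nil
    then show ?case using scal[of x] scalar_closed[of x l] by (simp add: scalar_def)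
  next
    case (Cons i w)
    have "Poly_Mapping.single (i # w) x = generator i * Poly_Mapping.single w x"
      by (simp add: generator_def mult_single plus_list_def)
    with Cons show ?case
      using mult[of "generator i" "Poly_Mapping.single w x"] gen generator_closed[of i l]
      by (auto intro: free_algebra_mult_closed)
  qed
  have "(\<Sum>w\<in>W. Poly_Mapping.single w (f w)) \<in> ?F \<and>
      chi (?cl (\<Sum>w\<in>W. Poly_Mapping.single w (f w))) = (\<Sum>w\<in>W. f w)"
    if "finite W" "W \<subseteq> lists {1..l}" for W f
    using that
  proof (induction W)
    case empty
    then show ?case using scal[of 0] scalar_closed[of 0 l] by (simp add: scalar_def)
  next
    case (insert w W)
    then show ?case
      using single[of w "f w"] add[of "Poly_Mapping.single w (f w)"] by (auto intro: free_algebra_add_closed)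
  qed
  from this[of "Poly_Mapping.keys p" "Poly_Mapping.lookup p"] p show ?thesis
    by (simp add: free_algebra_def augmentation_def flip: free_alg_expansion)
qed

lemma ex1_character_presented_algebra:
  assumes S: "S \<subseteq> carrier (free_algebra l)" and zero: "\<And>s. s \<in> S \<Longrightarrow> augmentation s = 0"
  shows "\<exists>!chi. chi \<in> extensional (carrier (presented_algebra l S)) \<and>
    is_character (presented_algebra l S) chi \<and>
    (\<forall>i\<in>{1..l}. chi (quotient_class l S (generator i)) = 1)"
proof (rule ex1I)
  let ?A = "presented_algebra l S" and ?cl = "quotient_class l S" and ?F = "carrier (free_algebra l)"
  define chi where "chi = restrict (\<lambda>X. the_elem (augmentation ` X)) (carrier ?A)"
  have chi: "chi (?cl p) = augmentation p" if "p \<in> ?F" for p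
    using that by (simp add: chi_def carrier_presented_algebra augmentation_quotient_class[OF S zero])
  have "chi \<in> ring_hom ?A complex_field"
  proof (rule ring_hom_memI)
    fix X Y assume "X \<in> carrier ?A" "Y \<in> carrier ?A"
    then obtain x y where "x \<in> ?F" "y \<in> ?F" "X = ?cl x" "Y = ?cl y"
      by (auto simp: carrier_presented_algebra)
    then show "chi (X \<otimes>\<^bsub>?A\<^esub> Y) = chi X \<otimes>\<^bsub>complex_field\<^esub> chi Y"
      and "chi (X \<oplus>\<^bsub>?A\<^esub> Y) = chi X \<oplus>\<^bsub>complex_field\<^esub> chi Y"
      by (simp_all add: quotient_class_mult[OF S] quotient_class_add[OF S] chi
          free_algebra_mult_closed free_algebra_add_closed augmentation_mult augmentation_add)
        (simp_all add: complex_field_def)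
  next
    show "chi \<one>\<^bsub>?A\<^esub> = \<one>\<^bsub>complex_field\<^esub>"
      by (simp add: quotient_class_one chi free_algebra_one_closed augmentation_one)
        (simp add: complex_field_def)
  qed (simp add: complex_field_def)
  moreover have "chi (x \<odot>\<^bsub>?A\<^esub> X) = x * chi X" if "X \<in> carrier ?A" for x X
    using that
    by (auto simp: carrier_presented_algebra quotient_class_smult[OF S] chi scalar_closed
        free_algebra_mult_closed augmentation_mult augmentation_scalar)
  ultimately show "chi \<in> extensional (carrier ?A) \<and> is_character ?A chi \<and>
      (\<forall>i\<in>{1..l}. chi (?cl (generator i)) = 1)"
    by (simp add: is_character_def chi generator_closed augmentation_generator)
      (simp add: chi_def)
  fix chi'
  assume chi': "chi' \<in> extensional (carrier ?A) \<and> is_character ?A chi' \<and>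
      (\<forall>i\<in>{1..l}. chi' (?cl (generator i)) = 1)"
  show "chi' = chi"
  proof (rule extensionalityI)
    fix X assume "X \<in> carrier ?A"
    then show "chi' X = chi X"
      using chi' by (auto simp: carrier_presented_algebra chi character_is_augmentation[OF S])
  qed (use chi' in \<open>auto simp: chi_def\<close>)
qed

section \<open>The twisted quantum Serre relations\<close>

lemma serre_relations_closed: "serre_relations l q a d c \<subseteq> carrier (free_algebra l)"
  unfolding serre_relations_def serre_element_def
  by (auto intro!: free_algebra_sum_closed free_algebra_mult_closed free_algebra_power_closed
      scalar_closed generator_closed)

lemma augmentation_serre_element:
  "augmentation (serre_element q a d c i j) =
    (\<Sum>r = 0..nat (1 - a i j).
      (- 1) ^ r * q powr (of_nat r * c i j) * q_binomial (q ^ d i) (nat (1 - a i j)) r)"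
  by (simp add: serre_element_def augmentation_sum augmentation_mult augmentation_power
      augmentation_generator augmentation_scalar)

text \<open>With \<open>n = - a i j\<close> and \<open>t = q^(d i)\<close>, the two possible values of \<open>c i j\<close> make \<open>q^(c i j)\<close> equal to
  \<open>t^(-n)\<close> or \<open>t^n\<close>, the two extreme roots of the alternating sum.\<close>
lemma augmentation_serre_element_eq_0:
  assumes q: "0 < norm q" "norm q < 1" and d: "d i > 0" and a: "a i j \<le> 0"
    and c: "c i j = of_int (int (d i) * a i j) \<or> c i j = - of_int (int (d i) * a i j)"
  shows "augmentation (serre_element q a d c i j) = 0"
proof -
  define n where "n = nat (- a i j)"
  define t where "t = q ^ d i"
  have n: "nat (1 - a i j) = Suc n" "a i j = - int n"
    using a by (auto simp: n_def)
  have "0 < norm t" "norm t < 1"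
    using q d by (auto simp: t_def norm_power power_less_one_iff)
  then have nz: "\<forall>k>0. q_int t k \<noteq> 0"
    by (simp add: q_int_nonzero)
  have pow: "q powr (of_nat r * of_int (int (d i) * int n)) = t ^ (r * n)" for r
  proof -
    have "q powr (of_nat r * of_int (int (d i) * int n)) = q powr (of_nat (d i * (r * n)))"
      by (simp add: algebra_simps)
    also have "\<dots> = t ^ (r * n)"
      using q by (subst powr_nat') (auto simp: t_def simp flip: power_mult)
    finally show ?thesis .
  qed
  from c show ?thesis
  proof
    assume c: "c i j = of_int (int (d i) * a i j)"
    have "q powr (of_nat r * c i j) = inverse t ^ (r * n)" for r
      using pow[of r] by (simp add: c n powr_minus power_inverse)
    then have "augmentation (serre_element q a d c i j) =
        (\<Sum>r=0..Suc n. (- 1) ^ r * inverse t ^ (r * n) * q_binomial t (Suc n) r)"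
      by (simp only: augmentation_serre_element n(1) flip: t_def)
    also have "\<dots> = 0"
      by (rule alternating_q_binomial_sum[of "inverse t" n,
            unfolded q_int_inverse q_binomial_inverse, OF nz])
    finally show ?thesis .
  next
    assume c: "c i j = - of_int (int (d i) * a i j)"
    have "q powr (of_nat r * c i j) = t ^ (r * n)" for r
      using pow[of r] by (simp add: c n)
    then have "augmentation (serre_element q a d c i j) =
        (\<Sum>r=0..Suc n. (- 1) ^ r * t ^ (r * n) * q_binomial t (Suc n) r)"
      by (simp only: augmentation_serre_element n(1) flip: t_def)
    also have "\<dots> = 0"
      by (rule alternating_q_binomial_sum[OF nz])
    finally show ?thesis .
  qed
qed

theorem proposition2:
  fixes sc :: "complex \<Rightarrow> 'g::ab_group_add \<Rightarrow> 'g"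
    and br :: "'g \<Rightarrow> 'g \<Rightarrow> 'g"
    and h :: "'g set"
    and l :: nat
    and \<alpha> :: "nat \<Rightarrow> 'g \<Rightarrow> complex"
    and a :: "nat \<Rightarrow> nat \<Rightarrow> int"
    and d :: "nat \<Rightarrow> nat"
    and B :: "('g \<Rightarrow> complex) \<Rightarrow> ('g \<Rightarrow> complex) \<Rightarrow> complex"
    and \<pi> :: "nat \<Rightarrow> nat"
    and q :: complex
    and V :: "('g \<Rightarrow> complex) set"
    and c :: "nat \<Rightarrow> nat \<Rightarrow> complex"
  assumes g: "simple_lie_algebra sc br"
    and h: "complex_lie_algebra.cartan_subalgebra sc br h"
    and V_def: "V = complex_lie_algebra.dual_space sc h"
    and simple_roots: "complex_lie_algebra.simple_roots sc br h l \<alpha>"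
    and cartan_matrix: "complex_lie_algebra.cartan_matrix sc br h l \<alpha> a"
    and d_pos: "\<forall>i\<in>{1..l}. d i > 0"
    and d_coprime: "Gcd (d ` {1..l}) = 1"
    and symmetric: "\<forall>i\<in>{1..l}. \<forall>j\<in>{1..l}. int (d i) * a i j = int (d j) * a j i"
    and form: "bilinear_form_on V B"
    and form_simple_roots:
      "\<forall>i\<in>{1..l}. \<forall>j\<in>{1..l}. B (\<alpha> i) (\<alpha> j) = of_int (int (d i) * a i j)"
    and q: "0 < norm q" "norm q < 1"
    and \<pi>: "\<pi> permutes {1..l}"
    and c_def: "c = coxeter_coeff V B \<alpha> l \<pi>"
  shows "\<exists>!chi. chi \<in> extensional (carrier (F_algebra l q a d c)) \<and>
    is_character (F_algebra l q a d c) chi \<and>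
    (\<forall>i\<in>{1..l}. chi (F_generator l q a d c i) = 1)"
proof -
  interpret L: simple_lie_algebra sc br by (rule g)
  interpret S: simple_root_system sc br h l \<alpha> a
    using L.finite_dimensional h simple_roots cartan_matrix by unfold_locales
  have sub: "functional.subspace V"
    by (metis V_def S.span_simple functional.subspace_span)
  interpret F: nondegenerate_form V B \<alpha> l
  proof
    show "bilinear_form_on V B" by (rule form)
    show "inj_on \<alpha> {1..l}" "functional.independent (\<alpha> ` {1..l})"
      using simple_roots by (simp_all add: L.simple_roots_def)
    show "functional.span (\<alpha> ` {1..l}) = V"
      by (simp only: V_def S.span_simple)
    fix i assume i: "i \<in> {1..l}"
    show "B (\<alpha> i) (\<alpha> i) \<noteq> 0"
      using form_simple_roots S.cartan_diagonal[OF i] d_pos i by simp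
  next
    fix v assume v: "v \<in> V" and orth: "\<forall>i\<in>{1..l}. B v (\<alpha> i) = 0"
    obtain x where x: "v = (\<Sum>j=1..l. fun_scale (x j) (\<alpha> j))"
      using S.dual_space_expansion v V_def by blast
    \<comment> \<open>\<open>B\<close> pairs \<open>v\<close> with \<open>\<alpha> i\<close> as \<open>d i\<close> times the coroot does, by symmetry of \<open>d i * a i j\<close>\<close>
    have "v (S.coroot i) = 0" if i: "i \<in> {1..l}" for i
    proof -
      have "B v (\<alpha> i) = (\<Sum>j=1..l. x j * B (\<alpha> j) (\<alpha> i))"
        unfolding x using i S.simple_in_dual V_def
        by (intro bilinear_form_on_sum[OF form sub]) auto
      also have "\<dots> = (\<Sum>j=1..l. of_nat (d i) * (x j * \<alpha> j (S.coroot i)))"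
      proof (intro sum.cong refl)
        fix j assume j: "j \<in> {1..l}"
        have "B (\<alpha> j) (\<alpha> i) = of_int (int (d i) * a i j)"
          using form_simple_roots symmetric i j by metis
        then show "x j * B (\<alpha> j) (\<alpha> i) = of_nat (d i) * (x j * \<alpha> j (S.coroot i))"
          by (simp add: S.coroot(2)[OF i j])
      qed
      also have "\<dots> = of_nat (d i) * v (S.coroot i)"
        by (simp add: x sum_fun_apply fun_scale_def sum_distrib_left)
      finally have "of_nat (d i) * v (S.coroot i) = 0"
        using orth i by metis
      moreover have "d i > 0"
        using d_pos i by blast
      ultimately show ?thesis by simp
    qed
    then show "v = 0"
      using S.coroots_separate v V_def by blast
  qed
  have "augmentation s = 0" if relation: "s \<in> serre_relations l q a d c" for s
  proof -
    obtain i j where ij: "i \<in> {1..l}" "j \<in> {1..l}" "i \<noteq> j" and s: "s = serre_element q a d c i j"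
      using relation unfolding serre_relations_def by blast
    have "c i j \<in> {B (\<alpha> i) (\<alpha> j), - B (\<alpha> i) (\<alpha> j)}"
      unfolding c_def by (rule F.coxeter_coeff_eq_plus_or_minus_form[OF \<pi> ij])
    then have "c i j = of_int (int (d i) * a i j) \<or> c i j = - of_int (int (d i) * a i j)"
      using form_simple_roots ij by auto
    then show ?thesis
      unfolding s using q d_pos ij S.cartan_off_diagonal[OF ij]
      by (intro augmentation_serre_element_eq_0) auto
  qed
  then show ?thesis
    unfolding F_algebra_def F_generator_def
    by (intro ex1_character_presented_algebra serre_relations_closed)
qed

end
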